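(* Let $d\ge1$ and let $\Omega\subset\mathbb{R}^d$ be an open bounded set with Lipschitz continuous boundary. Let $\{s_n\}_{n\in\mathbb{N}}\subset(0,1)$ be such that $s_n\to0^+$ as $n\to+\infty$. (i) (Compactness) Let $\{u^n\}_{n\in\mathbb{N}}\subset L^2(\Omega)$ be such that $\sup_{n\in\mathbb{N}}s_nF^{s_n}(u^n)\le C$ for some constant $C\in\mathbb{R}$. Then, up to a subsequence, $u^n\rightharpoonup u$ weakly in $L^2(\Omega)$ for some $u\in L^2(\Omega)$. (ii) ($\Gamma$-liminf inequality) For every $u\in L^2(\Omega)$ and for every $\{u^n\}_{n\in\mathbb{N}}\subset L^2(\Omega)$ with $u^n\rightharpoonup u$ weakly in $L^2(\Omega)$, it holds $$F^0(u)\le\liminf_{n\to+\infty}s_nF^{s_n}(u^n).$$ (iii) ($\Gamma$-limsup inequality) For every $u\in L^2(\Omega)$ there exists a sequence $\{u^n\}_{n\in\mathbb{N}}\subset L^2(\Omega)$ with $u^n\to u$ strongly in $L^2(\Omega)$ such that $$F^0(u)=\lim_{n\to+\infty}s_nF^{s_n}(u^n).$$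
   Context: For measurable $u:\Omega\to\mathbb{R}$, $\tilde u$ denotes its extension by $0$ to $\mathbb{R}^d$. For $s\in(0,1)$ and measurable $v:\mathbb{R}^d\to\mathbb{R}$, $$[v]_s:=\Big[\int_{\mathbb{R}^d}\int_{\mathbb{R}^d}\frac{|v(x)-v(y)|^2}{|x-y|^{d+2s}}\,dy\,dx\Big]^{1/2}\in[0,+\infty].$$ $F^s:L^2(\Omega)\to[0,+\infty]$ is $F^s(u):=\frac12[\tilde u]_s^2$, and $F^0:L^2(\Omega)\to[0,+\infty)$ is $F^0(u):=\frac{d\omega_d}{2}\|u\|_{L^2(\Omega)}^2$, where $\omega_d$ is the Lebesgue measure of the unit ball of $\mathbb{R}^d$. *)

theory Defs
  imports "HOL-Analysis.Analysis"
begin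

text \<open>
  \<open>\<real>\<^sup>d\<close> is rendered as an arbitrary type \<open>'a :: euclidean_space\<close> with \<open>d = DIM('a)\<close>, which is
  always at least 1.
\<close>

text \<open>
  Near each boundary point, \<open>\<Omega>\<close> is, after a rigid motion, the strict epigraph of a Lipschitz function
  of \<open>d - 1\<close> variables. The unit vector \<open>e\<close> is the vertical direction, and the hyperplane orthogonal
  to \<open>e\<close> plays the role of \<open>\<real>\<^sup>d\<^sup>-\<^sup>1\<close>, so that \<open>x - (x \<bullet> e) *\<^sub>R e\<close> is the horizontal part of \<open>x\<close>.
\<close>
definition lipschitz_boundary :: "'a::euclidean_space set \<Rightarrow> bool" where
  "lipschitz_boundary \<Omega> \<longleftrightarrow>
     (\<forall>p\<in>frontier \<Omega>. \<exists>r>0. \<exists>e::'a. \<exists>\<gamma>::'a \<Rightarrow> real. \<exists>L.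
        norm e = 1 \<and> L-lipschitz_on {y. y \<bullet> e = 0} \<gamma> \<and>
        \<Omega> \<inter> ball p r = {x \<in> ball p r. \<gamma> (x - (x \<bullet> e) *\<^sub>R e) < x \<bullet> e})"

text \<open>
  Elements of \<open>L\<^sup>2(\<Omega>)\<close> are handled through representatives, whose values outside \<open>\<Omega>\<close> are irrelevant;
  all notions below are invariant under changes on null sets.
\<close>
definition L2 :: "'a::euclidean_space set \<Rightarrow> ('a \<Rightarrow> real) set" where
  "L2 \<Omega> = {u \<in> borel_measurable (lebesgue_on \<Omega>). integrable (lebesgue_on \<Omega>) (\<lambda>x. (u x)\<^sup>2)}"

definition L2_inner :: "'a::euclidean_space set \<Rightarrow> ('a \<Rightarrow> real) \<Rightarrow> ('a \<Rightarrow> real) \<Rightarrow> real" where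
  "L2_inner \<Omega> u v = (LINT x|lebesgue_on \<Omega>. u x * v x)"

definition L2_norm :: "'a::euclidean_space set \<Rightarrow> ('a \<Rightarrow> real) \<Rightarrow> real" where
  "L2_norm \<Omega> u = sqrt (LINT x|lebesgue_on \<Omega>. (u x)\<^sup>2)"

definition L2_strongly_tendsto ::
    "'a::euclidean_space set \<Rightarrow> (nat \<Rightarrow> 'a \<Rightarrow> real) \<Rightarrow> ('a \<Rightarrow> real) \<Rightarrow> bool" where
  "L2_strongly_tendsto \<Omega> u v \<longleftrightarrow> (\<lambda>n. L2_norm \<Omega> (\<lambda>x. u n x - v x)) \<longlonglongrightarrow> 0"

definition L2_weakly_tendsto ::
    "'a::euclidean_space set \<Rightarrow> (nat \<Rightarrow> 'a \<Rightarrow> real) \<Rightarrow> ('a \<Rightarrow> real) \<Rightarrow> bool" where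
  "L2_weakly_tendsto \<Omega> u v \<longleftrightarrow>
     (\<forall>\<phi>\<in>L2 \<Omega>. (\<lambda>n. L2_inner \<Omega> (u n) \<phi>) \<longlonglongrightarrow> L2_inner \<Omega> v \<phi>)"

definition zero_ext :: "'a set \<Rightarrow> ('a \<Rightarrow> real) \<Rightarrow> 'a \<Rightarrow> real" where
  "zero_ext \<Omega> u = (\<lambda>x. if x \<in> \<Omega> then u x else 0)"

definition ennreal_sqrt :: "ennreal \<Rightarrow> ennreal" where
  "ennreal_sqrt a = (if a = top then top else ennreal (sqrt (enn2real a)))"

text \<open>
  On the diagonal \<open>x = y\<close>, a null set, the integrand is \<open>0 / 0 = 0\<close>.
\<close>
definition gagliardo_seminorm :: "real \<Rightarrow> ('a::euclidean_space \<Rightarrow> real) \<Rightarrow> ennreal" where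
  "gagliardo_seminorm s v = ennreal_sqrt
     (\<integral>\<^sup>+x. (\<integral>\<^sup>+y. ennreal (\<bar>v x - v y\<bar>\<^sup>2 / norm (x - y) powr (real DIM('a) + 2 * s)) \<partial>lebesgue)
       \<partial>lebesgue)"

definition F_frac :: "'a::euclidean_space set \<Rightarrow> real \<Rightarrow> ('a \<Rightarrow> real) \<Rightarrow> ennreal" where
  "F_frac \<Omega> s u = ennreal (1 / 2) * (gagliardo_seminorm s (zero_ext \<Omega> u))\<^sup>2"

definition F_zero :: "'a::euclidean_space set \<Rightarrow> ('a \<Rightarrow> real) \<Rightarrow> real" where
  "F_zero \<Omega> u = real DIM('a) * measure lebesgue (ball (0::'a) 1) / 2 * (L2_norm \<Omega> u)\<^sup>2"

end

theory Submission
  imports Defs "HOL-Complex_Analysis.Great_Picard"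
begin

text \<open>
  Let \<open>D\<close> exceed the diameter of \<open>\<Omega>\<close>. If \<open>\<bar>x - y\<bar> \<ge> D\<close>, then at least one of \<open>x\<close>, \<open>y\<close> lies outside \<open>\<Omega>\<close>,
  so that the pairs at distance at least \<open>D\<close> alone contribute exactly
  \<open>2 \<parallel>u\<parallel>\<^sup>2 \<integral>\<^bsub>\<bar>h\<bar> \<ge> D\<^esub> \<bar>h\<bar> powr (- d - 2 s) dh\<close> to \<open>[u]\<^sub>s\<^sup>2\<close>. This gives
  \<open>D powr (- 2 s) * F\<^sup>0(u) \<le> s * F\<^sup>s(u)\<close> for every \<open>u\<close>, and hence both the compactness (bounded sequences
  in \<open>L\<^sup>2\<close> are weakly precompact) and the liminf inequality (the norm is weakly lower semicontinuous).
  Conversely, for a Lipschitz function \<open>\<phi>\<close> vanishing outside \<open>\<Omega>\<close>, splitting the double integral at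
  \<open>\<bar>x - y\<bar> = 1\<close> shows \<open>s * F\<^sup>s(\<phi>) \<le> F\<^sup>0(\<phi>) + C s\<close>, with \<open>C\<close> depending on \<open>\<phi>\<close> only. Such functions are dense in \<open>L\<^sup>2(\<Omega>)\<close>,
  and a diagonal argument produces the recovery sequences.
\<close>

section \<open>Integrals of the kernel\<close>

text \<open>Multiplying by \<open>s\<close> yields a nontrivial limit because the kernel
  \<open>1 / norm h powr (d + 2 * s)\<close> has mass of order \<open>1 / s\<close> at infinity:
  outside the ball of radius \<open>D\<close> it is
  \<open>d * \<omega> * D powr (- 2 * s) / (2 * s)\<close>, with \<open>d * \<omega>\<close> the
  area of the unit sphere. Since \<open>D powr (- 2 * s)\<close> tends to 1, the cut-off radius does
  not affect the limiting constant: it can exceed the diameter in the lower bound and be 1 in the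
  upper bound, and the two bounds still meet. The singularity on the diagonal is the obstacle for
  the recovery sequence. It adds only a bounded amount for a Lipschitz function, but for a rough
  function it can make \<open>F_frac\<close> infinite for every \<open>s\<close>, so the constant
  sequence \<open>v\<close> is not admissible in general. As the constant \<open>C\<close> may grow
  with the Lipschitz constant of the approximants, these have to be traversed slowly compared with
  the decay of \<open>s n\<close>.\<close>

lemma nn_integral_powr_tail:
  fixes p c :: real
  assumes "p > 0" "c > 0"
  shows "(\<integral>\<^sup>+t. ennreal (t powr (- p - 1)) * indicator {c..} t \<partial>lborel) = ennreal (c powr (- p) / p)"
proof -
  have "((\<lambda>t. t powr (- p - 1)) has_integral (c powr (- p) / p)) {c..}"
    using has_integral_powr_to_inf[of "- p - 1" c] assms by simp
  from nn_integral_has_integral_lebesgue[OF _ this] show ?thesis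
    by (simp add: mult.commute ennreal_mult' ennreal_indicator[symmetric])
qed

text \<open>
  This substitutes for polar coordinates: \<open>\<bar>h\<bar> powr (- p)\<close> is the integral of \<open>p * t powr (- p - 1)\<close>
  over \<open>t \<ge> \<bar>h\<bar>\<close>.
\<close>

lemma nn_integral_norm_powr_layer_cake:
  fixes A :: "'a::euclidean_space set"
  assumes [measurable]: "A \<in> sets borel" and p: "p > 0"
  shows "(\<integral>\<^sup>+h. ennreal (1 / norm h powr p) * indicator A h \<partial>lborel) =
    (\<integral>\<^sup>+t. ennreal (p * t powr (- p - 1)) * indicator {0<..} t * emeasure lborel (A \<inter> cball 0 t) \<partial>lborel)"
proof -
  define g :: "'a \<Rightarrow> real \<Rightarrow> ennreal" where
    "g = (\<lambda>h t. ennreal (p * t powr (- p - 1)) * indicator {0<..} t * (indicator A h * indicator {h. norm h \<le> t} h))"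
  \<comment> \<open>Seen as a set of pairs, the condition is jointly measurable in \<open>h\<close>
    and \<open>t\<close>, as Fubini requires.\<close>
  have ind: "indicator {h. norm h \<le> t} h = (indicator {x. norm (fst x) \<le> snd x} (h, t) :: ennreal)" for h :: 'a and t
    by (auto simp: indicator_def)
  have m [measurable]: "(\<lambda>(h, t). g h t) \<in> borel_measurable (lborel \<Otimes>\<^sub>M lborel)"
    unfolding g_def ind by measurable
  have "(\<integral>\<^sup>+h. ennreal (1 / norm h powr p) * indicator A h \<partial>lborel) = (\<integral>\<^sup>+h. (\<integral>\<^sup>+t. g h t \<partial>lborel) \<partial>lborel)"
  proof (rule nn_integral_cong_AE)
    \<comment> \<open>The origin must be excluded: there the left side is \<open>1 / 0 = 0\<close>,
      while the integral over all \<open>t > 0\<close> diverges if the origin lies in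
      \<open>A\<close>.\<close>
    show "AE h in lborel. ennreal (1 / norm h powr p) * indicator A h = (\<integral>\<^sup>+t. g h t \<partial>lborel)"
      using AE_lborel_singleton[of "0::'a"]
    proof eventually_elim
      case (elim h)
      have "(\<integral>\<^sup>+t. g h t \<partial>lborel) =
          (\<integral>\<^sup>+t. (ennreal p * indicator A h) * (ennreal (t powr (- p - 1)) * indicator {norm h..} t) \<partial>lborel)"
        using elim p less_le_trans[of 0 "norm h"]
        by (intro nn_integral_cong) (fastforce simp: g_def indicator_def ennreal_mult)
      also have "\<dots> = ennreal p * indicator A h * ennreal (norm h powr (- p) / p)"
        using elim p by (simp add: nn_integral_cmult nn_integral_powr_tail)
      also have "\<dots> = ennreal (1 / norm h powr p) * indicator A h"
        using elim p by (simp add: ennreal_mult[symmetric] powr_minus field_simps indicator_def)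
      finally show ?case ..
    qed
  qed
  also have "\<dots> = (\<integral>\<^sup>+t. (\<integral>\<^sup>+h. g h t \<partial>lborel) \<partial>lborel)"
    by (rule lborel_pair.Fubini'[symmetric]) (rule m)
  also have "\<dots> = (\<integral>\<^sup>+t. ennreal (p * t powr (- p - 1)) * indicator {0<..} t * emeasure lborel (A \<inter> cball 0 t) \<partial>lborel)"
  proof (rule nn_integral_cong)
    fix t :: real
    have "g h t = ennreal (p * t powr (- p - 1)) * indicator {0<..} t * indicator (A \<inter> cball 0 t) h" for h
      by (simp add: g_def indicator_def dist_norm)
    then show "(\<integral>\<^sup>+h. g h t \<partial>lborel) = ennreal (p * t powr (- p - 1)) * indicator {0<..} t *
        emeasure lborel (A \<inter> cball 0 t)"
      by (simp add: nn_integral_cmult_indicator)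
  qed
  finally show ?thesis .
qed

lemma emeasure_ball_conv_unit_ball:
  assumes "t \<ge> 0"
  shows "emeasure lborel (ball (0::'a::euclidean_space) t) =
    ennreal (measure lebesgue (ball (0::'a) 1) * t ^ DIM('a))"
proof -
  have "emeasure lborel (ball (0::'a) t) = emeasure lebesgue (ball (0::'a) t)"
    by simp
  also have "\<dots> = ennreal (measure lebesgue (ball (0::'a) t))"
    by (rule emeasure_eq_measure2) simp
  also have "measure lebesgue (ball (0::'a) t) = measure lebesgue (ball (0::'a) 1) * t ^ DIM('a)"
    using content_ball_conv_unit_ball[OF assms, of "0::'a"] by (simp add: mult.commute)
  finally show ?thesis .
qed

lemma emeasure_cball_conv_unit_ball:
  assumes "t \<ge> 0"
  shows "emeasure lborel (cball (0::'a::euclidean_space) t) =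
    ennreal (measure lebesgue (ball (0::'a) 1) * t ^ DIM('a))"
proof -
  have "emeasure lborel (cball (0::'a) t) = emeasure lebesgue (cball (0::'a) t)"
    by simp
  also have "\<dots> = ennreal (measure lebesgue (cball (0::'a) t))"
    by (rule emeasure_eq_measure2) simp
  also have "measure lebesgue (cball (0::'a) t) = measure lebesgue (ball (0::'a) 1) * t ^ DIM('a)"
    using content_ball_conv_unit_ball[OF assms, of "0::'a"] content_cball_conv_ball[of "0::'a" t]
    by (simp add: mult.commute)
  finally show ?thesis .
qed

text \<open>The layer-cake formula reduces the integral to the volume
  \<open>\<omega> * (t ^ d - D ^ d)\<close> of a spherical shell, hence to two power integrals over
  \<open>t \<ge> D\<close>. The factor \<open>1 / (2 * s)\<close> is the blow-up that the prefactor
  \<open>s\<close> of the energy compensates.\<close>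

lemma nn_integral_riesz_kernel_outside_ball:
  fixes D s :: real
  assumes D: "D > 0" and s: "s > 0"
  shows "(\<integral>\<^sup>+h. ennreal (1 / norm (h::'a::euclidean_space) powr (real DIM('a) + 2 * s)) * indicator (- ball 0 D) h \<partial>lborel)
    = ennreal (real DIM('a) * measure lebesgue (ball (0::'a) 1) * D powr (- 2 * s) / (2 * s))"
proof -
  define d where "d = DIM('a)"
  define \<omega> where "\<omega> = measure lebesgue (ball (0::'a) 1)"
  define p where "p = real d + 2 * s"
  have \<omega>: "\<omega> \<ge> 0" and p: "p > 0"
    using s by (auto simp: d_def \<omega>_def p_def add_pos_pos)
  have annulus: "emeasure lborel (- ball 0 D \<inter> cball (0::'a) t) =
      ennreal (\<omega> * (t ^ d - D ^ d)) * indicator {D..} t" for t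
  proof (cases "t \<ge> D")
    case True
    have "- ball 0 D \<inter> cball (0::'a) t = cball 0 t - ball 0 D" by auto
    moreover have "emeasure lborel (cball 0 t - ball (0::'a) D) = emeasure lborel (cball (0::'a) t) - emeasure lborel (ball (0::'a) D)"
    proof (rule emeasure_Diff)
      show "emeasure lborel (ball (0::'a) D) \<noteq> \<infinity>"
        using emeasure_lborel_ball_finite[of "0::'a" D] by (metis infinity_ennreal_def less_irrefl)
      show "ball (0::'a) D \<subseteq> cball 0 t"
        using True by auto
    qed auto
    ultimately have "emeasure lborel (- ball 0 D \<inter> cball (0::'a) t) = emeasure lborel (cball (0::'a) t) - emeasure lborel (ball (0::'a) D)"
      by (rule trans[OF arg_cong])
    then show ?thesis
      using True D \<omega> emeasure_ball_conv_unit_ball[where 'a='a, of D] emeasure_cball_conv_unit_ball[where 'a='a, of t]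
      by (auto simp: d_def[symmetric] \<omega>_def[symmetric] ennreal_minus algebra_simps)
  next
    case False
    then have "- ball 0 D \<inter> cball (0::'a) t = {}" by auto
    then show ?thesis using False by simp
  qed
  have "(\<integral>\<^sup>+h. ennreal (1 / norm (h::'a) powr p) * indicator (- ball 0 D) h \<partial>lborel) =
      (\<integral>\<^sup>+t. ennreal (p * t powr (- p - 1)) * indicator {0<..} t *
        (ennreal (\<omega> * (t ^ d - D ^ d)) * indicator {D..} t) \<partial>lborel)"
    using p by (simp add: nn_integral_norm_powr_layer_cake annulus)
  also have "\<dots> = (\<integral>\<^sup>+t. ennreal (indicator {D..} t * (p * \<omega> * (t powr (- 2 * s - 1) - D ^ d * t powr (- p - 1)))) \<partial>lborel)"
  proof (rule nn_integral_cong)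
    fix t :: real
    have "t powr (- 2 * s - 1) = t ^ d * t powr (- p - 1)" if "t > 0"
      using that by (simp add: p_def powr_realpow[symmetric] powr_add[symmetric])
    then show "ennreal (p * t powr (- p - 1)) * indicator {0<..} t * (ennreal (\<omega> * (t ^ d - D ^ d)) * indicator {D..} t) =
      ennreal (indicator {D..} t * (p * \<omega> * (t powr (- 2 * s - 1) - D ^ d * t powr (- p - 1))))"
      using D p by (auto simp: indicator_def ennreal_mult'[symmetric] algebra_simps)
  qed
  also have "\<dots> = ennreal (p * \<omega> * (D powr (- 2 * s) / (2 * s) - D ^ d * (D powr (- p) / p)))"
  proof (rule nn_integral_has_integral_lebesgue)
    show "0 \<le> p * \<omega> * (t powr (- 2 * s - 1) - D ^ d * t powr (- p - 1))" if "t \<in> {D..}" for t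
    proof -
      have "t powr (- 2 * s - 1) = t ^ d * t powr (- p - 1)"
        using that D by (simp add: p_def powr_realpow[symmetric] powr_add[symmetric])
      moreover have "D ^ d \<le> t ^ d"
        using that D by (intro power_mono) auto
      ultimately have "0 \<le> t powr (- 2 * s - 1) - D ^ d * t powr (- p - 1)"
        by (auto intro: mult_right_mono)
      then show ?thesis using p \<omega> by simp
    qed
    have 1: "((\<lambda>t. t powr (- 2 * s - 1)) has_integral D powr (- 2 * s) / (2 * s)) {D..}"
      using has_integral_powr_to_inf[of "- 2 * s - 1" D] s D by simp
    have 2: "((\<lambda>t. t powr (- p - 1)) has_integral D powr (- p) / p) {D..}"
      using has_integral_powr_to_inf[of "- p - 1" D] p D by simp
    show "((\<lambda>t. p * \<omega> * (t powr (- 2 * s - 1) - D ^ d * t powr (- p - 1))) has_integral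
        p * \<omega> * (D powr (- 2 * s) / (2 * s) - D ^ d * (D powr (- p) / p))) {D..}"
      by (intro has_integral_mult_right has_integral_diff 1 2)
  qed
  \<comment> \<open>Here \<open>p * (1 / (2 * s) - 1 / p) = (p - 2 * s) / (2 * s)\<close> and
    \<open>p - 2 * s = d\<close>, which turns the volume of the ball into the area of the
    sphere.\<close>
  also have "p * \<omega> * (D powr (- 2 * s) / (2 * s) - D ^ d * (D powr (- p) / p)) = real d * \<omega> * D powr (- 2 * s) / (2 * s)"
  proof -
    have "D ^ d * D powr (- p) = D powr (- 2 * s)"
      using D by (simp add: p_def powr_realpow[symmetric] powr_add[symmetric])
    then have "p * \<omega> * (D powr (- 2 * s) / (2 * s) - D ^ d * (D powr (- p) / p)) =
       p * \<omega> * (D powr (- 2 * s) / (2 * s) - D powr (- 2 * s) / p)"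
      by (simp only: times_divide_eq_right)
    also have "\<dots> = real d * \<omega> * D powr (- 2 * s) / (2 * s)"
      using p s by (simp add: field_simps) (simp add: p_def algebra_simps)
    finally show ?thesis .
  qed
  finally show ?thesis by (simp add: p_def d_def \<omega>_def)
qed

text \<open>In the layer-cake formula the volume is at most \<open>\<omega> * t ^ d\<close> for
  small \<open>t\<close>, which leaves \<open>t powr (d - p - 1)\<close>, integrable at 0 since
  \<open>p < d\<close>; for \<open>t > 1\<close> it is at most \<open>\<omega>\<close>, and the tail
  converges since \<open>p > 0\<close>.\<close>

lemma nn_integral_norm_powr_unit_ball_finite:
  fixes p :: real
  assumes p: "0 < p" "p < real DIM('a)"
  shows "(\<integral>\<^sup>+h. ennreal (1 / norm (h::'a::euclidean_space) powr p) * indicator (ball 0 1) h \<partial>lborel) < top"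
proof -
  define d where "d = DIM('a)"
  define \<omega> where "\<omega> = measure lebesgue (ball (0::'a) 1)"
  have \<omega>: "\<omega> \<ge> 0" by (simp add: \<omega>_def)
  have b: "emeasure lborel (ball 0 1 \<inter> cball (0::'a) t) \<le> ennreal (\<omega> * t ^ d)" if "t \<ge> 0" for t
    using emeasure_mono[of "ball 0 1 \<inter> cball (0::'a) t" "cball 0 t" lborel] emeasure_cball_conv_unit_ball[where 'a='a, of t] that
    by (simp add: d_def \<omega>_def)
  have b': "emeasure lborel (ball 0 1 \<inter> cball (0::'a) t) \<le> ennreal \<omega>" for t
    using emeasure_mono[of "ball 0 1 \<inter> cball (0::'a) t" "ball 0 1" lborel] emeasure_ball_conv_unit_ball[where 'a='a, of 1]
    by (simp add: \<omega>_def)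
  have "(\<integral>\<^sup>+h. ennreal (1 / norm (h::'a) powr p) * indicator (ball 0 1) h \<partial>lborel) =
     (\<integral>\<^sup>+t. ennreal (p * t powr (- p - 1)) * indicator {0<..} t * emeasure lborel (ball 0 1 \<inter> cball (0::'a) t) \<partial>lborel)"
    using p by (simp add: nn_integral_norm_powr_layer_cake)
  also have "\<dots> \<le> (\<integral>\<^sup>+t. ennreal (p * \<omega>) * ennreal (indicator {0..1} t * t powr (real d - p - 1)) +
       ennreal (p * \<omega>) * (ennreal (t powr (- p - 1)) * indicator {1..} t) \<partial>lborel)"
  proof (rule nn_integral_mono)
    fix t :: real
    consider "t \<le> 0" | "0 < t" "t \<le> 1" | "t > 1" by linarith
    then show "ennreal (p * t powr (- p - 1)) * indicator {0<..} t * emeasure lborel (ball 0 1 \<inter> cball (0::'a) t)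
       \<le> ennreal (p * \<omega>) * ennreal (indicator {0..1} t * t powr (real d - p - 1)) +
       ennreal (p * \<omega>) * (ennreal (t powr (- p - 1)) * indicator {1..} t)"
    proof cases
      case 2
      have "ennreal (p * t powr (- p - 1)) * indicator {0<..} t * emeasure lborel (ball 0 1 \<inter> cball (0::'a) t)
        \<le> ennreal (p * t powr (- p - 1)) * ennreal (\<omega> * t ^ d)"
        using 2 by (auto intro!: mult_left_mono b)
      also have "\<dots> = ennreal (p * \<omega>) * ennreal (t powr (real d - p - 1))"
        using 2 p \<omega> by (simp add: ennreal_mult[symmetric] powr_realpow[symmetric] mult_ac powr_add[symmetric] diff_diff_eq2)
           (simp add: algebra_simps)
      finally show ?thesis using 2 by (auto intro: add_increasing2)
    next
      case 3
      have "ennreal (p * t powr (- p - 1)) * indicator {0<..} t * emeasure lborel (ball 0 1 \<inter> cball (0::'a) t)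
        \<le> ennreal (p * t powr (- p - 1)) * ennreal \<omega>"
        using 3 by (auto intro!: mult_left_mono b')
      also have "\<dots> = ennreal (p * \<omega>) * (ennreal (t powr (- p - 1)))"
        using 3 p \<omega> by (simp add: ennreal_mult[symmetric] mult_ac)
      finally show ?thesis using 3 by simp
    qed simp
  qed
  also have "\<dots> = ennreal (p * \<omega>) * (\<integral>\<^sup>+t. ennreal (indicator {0..1} t * t powr (real d - p - 1)) \<partial>lborel) +
       ennreal (p * \<omega>) * (\<integral>\<^sup>+t. ennreal (t powr (- p - 1)) * indicator {1..} t \<partial>lborel)"
    by (simp add: nn_integral_add nn_integral_cmult)
  also have "\<dots> < top"
  proof -
    have "((\<lambda>t. t powr (real d - p - 1)) has_integral (1 powr (real d - p) / (real d - p))) {0..1}"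
      using has_integral_powr_from_0[of "real d - p - 1" 1] p by (simp add: d_def)
    from nn_integral_has_integral_lebesgue[OF _ this]
    show ?thesis using p
      by (simp add: nn_integral_powr_tail ennreal_mult_less_top)
  qed
  finally show ?thesis .
qed

section \<open>Bounds for the fractional seminorm\<close>

lemma ennreal_sqrt_square: "(ennreal_sqrt a)\<^sup>2 = a"
  by (cases a) (auto simp: ennreal_sqrt_def ennreal_power)

text \<open>The nonnegative integral does not change under completion of the measure, whatever the
  integrand, and squaring removes the root. On \<open>lborel\<close>, Fubini is available for Borel
  functions.\<close>

lemma F_frac_eq_lborel:
  "F_frac \<Omega> s (u :: 'a::euclidean_space \<Rightarrow> real) = ennreal (1 / 2) *
    (\<integral>\<^sup>+x. (\<integral>\<^sup>+y. ennreal (\<bar>zero_ext \<Omega> u x - zero_ext \<Omega> u y\<bar>\<^sup>2 / norm (x - y) powr (real DIM('a) + 2 * s))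
      \<partial>lborel) \<partial>lborel)"
  by (simp add: F_frac_def gagliardo_seminorm_def ennreal_sqrt_square nn_integral_completion)

section \<open>Double integrals with a translation-invariant kernel\<close>

lemma nn_integral_lborel_translate:
  fixes f :: "'a::euclidean_space \<Rightarrow> ennreal"
  assumes [measurable]: "f \<in> borel_measurable borel"
  shows "(\<integral>\<^sup>+y. f (y - x) \<partial>lborel) = (\<integral>\<^sup>+y. f y \<partial>lborel)"
proof -
  have "(\<integral>\<^sup>+y. f y \<partial>lborel) = (\<integral>\<^sup>+y. f y \<partial>distr lborel borel ((+) (- x)))"
    by (simp add: lborel_distr_plus)
  also have "\<dots> = (\<integral>\<^sup>+y. f (- x + y) \<partial>lborel)"
    by (rule nn_integral_distr) auto
  finally show ?thesis by simp
qed

lemma nn_integral_convolution_fst: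
  fixes f g :: "'a::euclidean_space \<Rightarrow> ennreal"
  assumes [measurable]: "f \<in> borel_measurable borel" "g \<in> borel_measurable borel"
  shows "(\<integral>\<^sup>+x. (\<integral>\<^sup>+y. g x * f (y - x) \<partial>lborel) \<partial>lborel) = (\<integral>\<^sup>+x. g x \<partial>lborel) * (\<integral>\<^sup>+y. f y \<partial>lborel)"
  by (simp add: nn_integral_cmult nn_integral_multc nn_integral_lborel_translate)

text \<open>Fubini exchanges the roles of \<open>x\<close> and \<open>y\<close>, and evenness of the
  kernel reduces the claim to the previous case.\<close>

lemma nn_integral_convolution_snd:
  fixes f g :: "'a::euclidean_space \<Rightarrow> ennreal"
  assumes [measurable]: "f \<in> borel_measurable borel" "g \<in> borel_measurable borel"
    and even: "\<And>h. f (- h) = f h"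
  shows "(\<integral>\<^sup>+x. (\<integral>\<^sup>+y. g y * f (y - x) \<partial>lborel) \<partial>lborel) = (\<integral>\<^sup>+x. g x \<partial>lborel) * (\<integral>\<^sup>+y. f y \<partial>lborel)"
proof -
  have "(\<integral>\<^sup>+x. (\<integral>\<^sup>+y. g y * f (y - x) \<partial>lborel) \<partial>lborel) = (\<integral>\<^sup>+y. (\<integral>\<^sup>+x. g y * f (y - x) \<partial>lborel) \<partial>lborel)"
    by (rule lborel_pair.Fubini') measurable
  also have "\<dots> = (\<integral>\<^sup>+y. (\<integral>\<^sup>+x. g y * f (x - y) \<partial>lborel) \<partial>lborel)"
  proof (intro nn_integral_cong)
    fix x y :: 'a
    show "g y * f (y - x) = g y * f (x - y)"
      using even[of "x - y"] by simp
  qed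
  finally show ?thesis
    by (simp add: nn_integral_convolution_fst)
qed

lemma nn_integral_square_eq_L2_norm:
  fixes u :: "'a::euclidean_space \<Rightarrow> real"
  assumes "\<Omega> \<in> sets lebesgue" "u \<in> L2 \<Omega>"
  shows "(\<integral>\<^sup>+x. ennreal ((zero_ext \<Omega> u x)\<^sup>2) \<partial>lborel) = ennreal ((L2_norm \<Omega> u)\<^sup>2)"
proof -
  have i: "integrable (lebesgue_on \<Omega>) (\<lambda>x. (u x)\<^sup>2)"
    using assms by (simp add: L2_def)
  have "ennreal ((L2_norm \<Omega> u)\<^sup>2) = ennreal (LINT x|lebesgue_on \<Omega>. (u x)\<^sup>2)"
    by (simp add: L2_norm_def)
  also have "\<dots> = (\<integral>\<^sup>+x. ennreal ((u x)\<^sup>2) \<partial>lebesgue_on \<Omega>)"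
    using i by (simp add: nn_integral_eq_integral)
  also have "\<dots> = (\<integral>\<^sup>+x. ennreal ((u x)\<^sup>2) * indicator \<Omega> x \<partial>lebesgue)"
    using assms by (intro nn_integral_restrict_space) auto
  also have "\<dots> = (\<integral>\<^sup>+x. ennreal ((zero_ext \<Omega> u x)\<^sup>2) \<partial>lborel)"
    unfolding nn_integral_completion by (intro nn_integral_cong) (auto simp: zero_ext_def indicator_def)
  finally show ?thesis ..
qed

text \<open>Elements of \<open>L2\<close> are only Lebesgue measurable, whereas Fubini on
  \<open>lborel\<close> asks for Borel functions. Multiplying by the indicator makes the
  representative vanish at every point outside \<open>\<Omega>\<close>, not just almost every one;
  the lower bound uses this pointwise.\<close>

lemma L2_borel_representative:
  fixes u :: "'a::euclidean_space \<Rightarrow> real"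
  assumes "open \<Omega>" "u \<in> L2 \<Omega>"
  obtains v where "v \<in> borel_measurable borel" "\<And>x. x \<notin> \<Omega> \<Longrightarrow> v x = 0"
    "AE x in lborel. zero_ext \<Omega> u x = v x"
proof -
  have \<Omega>: "\<Omega> \<in> sets borel" "\<Omega> \<inter> space lebesgue \<in> sets lebesgue"
    using assms by auto
  have "(\<lambda>x. indicator \<Omega> x *\<^sub>R u x) \<in> borel_measurable lebesgue"
    using assms(2) borel_measurable_restrict_space_iff[OF \<Omega>(2), of u] by (simp add: L2_def)
  then obtain w where w: "w \<in> borel_measurable lborel" "AE x in lborel. indicator \<Omega> x *\<^sub>R u x = w x"
    using completion_ex_borel_measurable_real by blast
  show ?thesis
  proof (rule that[of "\<lambda>x. indicator \<Omega> x * w x"])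
    show "AE x in lborel. zero_ext \<Omega> u x = indicator \<Omega> x * w x"
      using w(2) by eventually_elim (auto simp: zero_ext_def indicator_def split: if_splits)
    show "(\<lambda>x. indicator \<Omega> x * w x) \<in> borel_measurable borel"
      using w(1) \<Omega>(1) by auto
  qed auto
qed

text \<open>The truncated kernel \<open>f\<close> retains the far pairs only. They are counted once
  through \<open>x\<close> and once through \<open>y\<close>, which cancels the factor
  \<open>1 / 2\<close> in \<open>F_frac\<close>. The whole chain lives in \<open>ennreal\<close>
  without subtraction, so infinite energy is covered.\<close>

lemma F_frac_lower_bound:
  fixes u :: "'a::euclidean_space \<Rightarrow> real"
  assumes "open \<Omega>" and u: "u \<in> L2 \<Omega>" and D: "D > 0" "\<And>x y. x \<in> \<Omega> \<Longrightarrow> y \<in> \<Omega> \<Longrightarrow> dist x y < D" and s: "s > 0"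
  shows "ennreal (D powr (- 2 * s) * F_zero \<Omega> u) \<le> ennreal s * F_frac \<Omega> s u"
proof -
  define c where "c = real DIM('a) * measure lebesgue (ball (0::'a) 1)"
  have c: "c \<ge> 0" by (simp add: c_def)
  have half: "ennreal (s / 2) = ennreal s * ennreal (1 / 2)"
    using s ennreal_mult'[of s "1 / 2"] by (simp only: times_divide_eq_right mult_1_right less_imp_le)
  obtain v where [measurable]: "v \<in> borel_measurable borel" and v0: "\<And>x. x \<notin> \<Omega> \<Longrightarrow> v x = 0"
    and ae: "AE x in lborel. zero_ext \<Omega> u x = v x"
    using L2_borel_representative[OF assms(1,2)] by blast
  define f where "f = (\<lambda>h::'a. ennreal (1 / norm h powr (real DIM('a) + 2 * s)) * indicator (- ball 0 D) h)"
  have [measurable]: "f \<in> borel_measurable borel" unfolding f_def by measurable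
  have f: "(\<integral>\<^sup>+h. f h \<partial>lborel) = ennreal (c * D powr (- 2 * s) / (2 * s))"
    unfolding f_def c_def by (rule nn_integral_riesz_kernel_outside_ball[OF D(1) s])
  have v2: "(\<integral>\<^sup>+x. ennreal ((v x)\<^sup>2) \<partial>lborel) = ennreal ((L2_norm \<Omega> u)\<^sup>2)"
  proof -
    have "(\<integral>\<^sup>+x. ennreal ((v x)\<^sup>2) \<partial>lborel) = (\<integral>\<^sup>+x. ennreal ((zero_ext \<Omega> u x)\<^sup>2) \<partial>lborel)"
      using ae by (intro nn_integral_cong_AE) (auto elim!: eventually_mono)
    then show ?thesis using u assms(1) by (simp add: nn_integral_square_eq_L2_norm)
  qed
  have feven: "f (- h) = f h" for h
    by (simp add: f_def indicator_def)
  have i1: "(\<integral>\<^sup>+x. (\<integral>\<^sup>+y. ennreal ((v x)\<^sup>2) * f (y - x) \<partial>lborel) \<partial>lborel) =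
      ennreal ((L2_norm \<Omega> u)\<^sup>2) * ennreal (c * D powr (- 2 * s) / (2 * s))"
    using nn_integral_convolution_fst[of f "\<lambda>x. ennreal ((v x)\<^sup>2)"] by (simp add: v2 f)
  have i2: "(\<integral>\<^sup>+x. (\<integral>\<^sup>+y. ennreal ((v y)\<^sup>2) * f (y - x) \<partial>lborel) \<partial>lborel) =
      ennreal ((L2_norm \<Omega> u)\<^sup>2) * ennreal (c * D powr (- 2 * s) / (2 * s))"
    using nn_integral_convolution_snd[of f "\<lambda>x. ennreal ((v x)\<^sup>2)"] by (simp add: v2 f feven)
  have "2 * ennreal ((L2_norm \<Omega> u)\<^sup>2) * ennreal (c * D powr (- 2 * s) / (2 * s)) =
     (\<integral>\<^sup>+x. (\<integral>\<^sup>+y. ennreal ((v x)\<^sup>2) * f (y - x) \<partial>lborel) \<partial>lborel) + (\<integral>\<^sup>+x. (\<integral>\<^sup>+y. ennreal ((v y)\<^sup>2) * f (y - x) \<partial>lborel) \<partial>lborel)"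
    unfolding i1 i2 by (simp only: mult_2 distrib_right)
  also have "\<dots> = (\<integral>\<^sup>+x. (\<integral>\<^sup>+y. ennreal ((v x)\<^sup>2) * f (y - x) + ennreal ((v y)\<^sup>2) * f (y - x) \<partial>lborel) \<partial>lborel)"
    by (simp add: nn_integral_add)
  also have "\<dots> \<le> (\<integral>\<^sup>+x. (\<integral>\<^sup>+y. ennreal (\<bar>v x - v y\<bar>\<^sup>2 / norm (x - y) powr (real DIM('a) + 2 * s)) \<partial>lborel) \<partial>lborel)"
  proof (intro nn_integral_mono)
    fix x y :: 'a
    show "ennreal ((v x)\<^sup>2) * f (y - x) + ennreal ((v y)\<^sup>2) * f (y - x) \<le>
      ennreal (\<bar>v x - v y\<bar>\<^sup>2 / norm (x - y) powr (real DIM('a) + 2 * s))"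
    proof (cases "dist x y < D")
      case True
      then show ?thesis by (simp add: f_def indicator_def dist_norm norm_minus_commute)
    next
      case False
      \<comment> \<open>With one of the two values zero, the mixed term of the square disappears,
        and the comparison is an equality on these pairs.\<close>
      then have "v x = 0 \<or> v y = 0" using D(2) v0 by blast
      moreover have "f (y - x) = ennreal (1 / norm (x - y) powr (real DIM('a) + 2 * s))"
        using False by (simp add: f_def indicator_def dist_norm norm_minus_commute)
      ultimately show ?thesis
        by (auto simp: ennreal_mult'[symmetric] ennreal_mult[symmetric])
    qed
  qed
  also have "\<dots> = (\<integral>\<^sup>+x. (\<integral>\<^sup>+y. ennreal (\<bar>zero_ext \<Omega> u x - zero_ext \<Omega> u y\<bar>\<^sup>2 / norm (x - y) powr (real DIM('a) + 2 * s)) \<partial>lborel) \<partial>lborel)"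
    (is "_ = ?I")
  \<comment> \<open>Two exceptional null sets occur: one of points \<open>x\<close>, and, for each
    remaining \<open>x\<close>, one of points \<open>y\<close> in the inner integral.\<close>
  proof (rule nn_integral_cong_AE, use ae in eventually_elim)
    case (elim x)
    show ?case using ae by (intro nn_integral_cong_AE, eventually_elim) (simp add: elim)
  qed
  finally have "ennreal (s / 2) * (2 * ennreal ((L2_norm \<Omega> u)\<^sup>2) * ennreal (c * D powr (- 2 * s) / (2 * s)))
     \<le> ennreal (s / 2) * ?I"
    by (rule mult_left_mono) simp
  also have "\<dots> = ennreal s * F_frac \<Omega> s u"
    unfolding F_frac_eq_lborel half mult.assoc ..
  also have "ennreal (s / 2) * (2 * ennreal ((L2_norm \<Omega> u)\<^sup>2) * ennreal (c * D powr (- 2 * s) / (2 * s)))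
     = ennreal (s / 2 * (2 * (L2_norm \<Omega> u)\<^sup>2 * (c * D powr (- 2 * s) / (2 * s))))"
  proof -
    have "ennreal a * (2 * ennreal b * ennreal e) = ennreal (a * (2 * b * e))" if "0 \<le> a" "0 \<le> b" "0 \<le> e" for a b e
      using that by (simp add: ennreal_mult)
    then show ?thesis using s c by simp
  qed
  also have "s / 2 * (2 * (L2_norm \<Omega> u)\<^sup>2 * (c * D powr (- 2 * s) / (2 * s))) = D powr (- 2 * s) * F_zero \<Omega> u"
    using s by (simp add: F_zero_def c_def)
  finally show ?thesis .
qed

text \<open>The integrand is majorized by five terms. \<open>?t1\<close> and \<open>?t2\<close>
  handle near pairs, of which at least one point lies in \<open>\<Omega>\<close>; \<open>?t3\<close>
  and \<open>?t4\<close> are the squares over far pairs and reproduce \<open>F_zero\<close>;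
  \<open>?t5\<close> is the mixed term over far pairs, bounded by the squared integral of
  \<open>\<bar>\<phi>\<bar>\<close>. Only \<open>?t3\<close> and \<open>?t4\<close> have integrals
  of order \<open>1 / s\<close>.\<close>

lemma F_frac_upper_bound_lipschitz:
  fixes \<phi> :: "'a::euclidean_space \<Rightarrow> real"
  assumes "open \<Omega>" "bounded \<Omega>" and lip: "L-lipschitz_on UNIV \<phi>" and \<phi>0: "\<And>x. x \<notin> \<Omega> \<Longrightarrow> \<phi> x = 0"
    and \<phi>: "\<phi> \<in> L2 \<Omega>"
  obtains C where "\<And>s. 0 < s \<Longrightarrow> s \<le> 1 / 2 \<Longrightarrow> ennreal s * F_frac \<Omega> s \<phi> \<le> ennreal (F_zero \<Omega> \<phi> + s * C)"
proof -
  define c where "c = real DIM('a) * measure lebesgue (ball (0::'a) 1)"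
  have c: "c \<ge> 0" by (simp add: c_def)
  have ze: "zero_ext \<Omega> \<phi> = \<phi>"
    using \<phi>0 by (auto simp: zero_ext_def)
  have "continuous_on UNIV \<phi>" using lip by (rule lipschitz_on_continuous_on)
  then have [measurable]: "\<phi> \<in> borel_measurable borel" by (rule borel_measurable_continuous_onI)
  have [measurable]: "\<Omega> \<in> sets borel" using assms by auto
  \<comment> \<open>Near the diagonal the integrand is at most \<open>L\<^sup>2 \<bar>h\<bar> powr (2 - d - 2 s)\<close>. For \<open>s \<le> 1 / 2\<close> this is dominated by
    \<open>L\<^sup>2 \<bar>h\<bar> powr (- p)\<close>, which does not depend on \<open>s\<close>; here \<open>0 < p < d\<close> even when \<open>d = 1\<close>.\<close>
  define p where "p = real DIM('a) - 1 / 2"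
  have "1 \<le> real DIM('a)"
    using DIM_positive[where 'a='a] by linarith
  then have p: "0 < p" "p < real DIM('a)"
    unfolding p_def by linarith+
  define n where "n = (\<lambda>h::'a. ennreal (1 / norm h powr p) * indicator (ball 0 1) h)"
  have [measurable]: "n \<in> borel_measurable borel"
    unfolding n_def by (intro borel_measurable_times_ennreal borel_measurable_indicator) auto
  obtain \<kappa> where \<kappa>: "(\<integral>\<^sup>+h. n h \<partial>lborel) = ennreal \<kappa>" "\<kappa> \<ge> 0"
    using nn_integral_norm_powr_unit_ball_finite[OF p] unfolding n_def
    by (metis less_top_ennreal)
  define m where "m = measure lebesgue \<Omega>"
  have \<Omega>m: "emeasure lborel \<Omega> = ennreal m"
    using emeasure_eq_measure2[OF lmeasurable_open[OF assms(2,1)]] by (simp add: m_def)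
  have m: "m \<ge> 0" by (simp add: m_def)
  have neven: "n (- h) = n h" for h
    by (simp add: n_def indicator_def)
  have L\<Omega>: "(\<integral>\<^sup>+x. ennreal (L\<^sup>2) * indicator \<Omega> x \<partial>lborel) = ennreal (L\<^sup>2) * ennreal m"
    by (simp add: nn_integral_cmult_indicator \<Omega>m)
  have \<phi>2: "(\<integral>\<^sup>+x. ennreal ((\<phi> x)\<^sup>2) \<partial>lborel) = ennreal ((L2_norm \<Omega> \<phi>)\<^sup>2)"
    using nn_integral_square_eq_L2_norm[OF _ \<phi>] assms(1) by (simp add: ze)
  \<comment> \<open>The integral of \<open>\<bar>\<phi>\<bar>\<close> is finite because
    \<open>\<Omega>\<close> has finite measure: \<open>\<bar>\<phi> x\<bar>\<close> is at most
    \<open>(\<phi> x)\<^sup>2 + 1\<close> there and 0 elsewhere.\<close>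
  obtain b where b: "(\<integral>\<^sup>+x. ennreal \<bar>\<phi> x\<bar> \<partial>lborel) = ennreal b" "b \<ge> 0"
  proof -
    have "(\<integral>\<^sup>+x. ennreal \<bar>\<phi> x\<bar> \<partial>lborel) \<le> (\<integral>\<^sup>+x. ennreal ((\<phi> x)\<^sup>2) + indicator \<Omega> x \<partial>lborel)"
    proof (intro nn_integral_mono)
      fix x
      have "\<bar>\<phi> x\<bar> \<le> (\<phi> x)\<^sup>2 + 1"
        using zero_le_power2[of "\<bar>\<phi> x\<bar> - 1"] by (auto simp: power2_eq_square algebra_simps)
      then show "ennreal \<bar>\<phi> x\<bar> \<le> ennreal ((\<phi> x)\<^sup>2) + indicator \<Omega> x"
        using \<phi>0[of x] by (auto simp: indicator_def ennreal_plus[symmetric] ennreal_1[symmetric] simp del: ennreal_plus ennreal_1 intro!: ennreal_leI)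
    qed
    also have "\<dots> = ennreal ((L2_norm \<Omega> \<phi>)\<^sup>2) + ennreal m"
      by (simp add: nn_integral_add \<phi>2 \<Omega>m)
    also have "\<dots> < top" by simp
    finally show ?thesis using that by (metis less_top_ennreal)
  qed
  show ?thesis
  proof (rule that)
    fix s :: real assume s: "0 < s" "s \<le> 1 / 2"
    have half: "ennreal (s / 2) = ennreal s * ennreal (1 / 2)"
      using s ennreal_mult'[of s "1 / 2"] by (simp only: times_divide_eq_right mult_1_right less_imp_le)
    define k where "k = (\<lambda>h::'a. ennreal (1 / norm h powr (real DIM('a) + 2 * s)) * indicator (- ball 0 1) h)"
    have [measurable]: "k \<in> borel_measurable borel" unfolding k_def by measurable
    have keven: "k (- h) = k h" for h
      by (simp add: k_def indicator_def)
    have k: "(\<integral>\<^sup>+h. k h \<partial>lborel) = ennreal (c / (2 * s))"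
      using nn_integral_riesz_kernel_outside_ball[of 1 s, where 'a='a] s unfolding k_def c_def by simp
    let ?t1 = "\<lambda>x y. (ennreal (L\<^sup>2) * indicator \<Omega> x) * n (y - x)"
    let ?t2 = "\<lambda>x y. (ennreal (L\<^sup>2) * indicator \<Omega> y) * n (y - x)"
    let ?t3 = "\<lambda>x y. ennreal ((\<phi> x)\<^sup>2) * k (y - x)"
    let ?t4 = "\<lambda>x y. ennreal ((\<phi> y)\<^sup>2) * k (y - x)"
    let ?t5 = "\<lambda>x y. ennreal (2 * \<bar>\<phi> x\<bar>) * ennreal \<bar>\<phi> y\<bar>"
    have "(\<integral>\<^sup>+x. (\<integral>\<^sup>+y. ennreal (\<bar>\<phi> x - \<phi> y\<bar>\<^sup>2 / norm (x - y) powr (real DIM('a) + 2 * s)) \<partial>lborel) \<partial>lborel)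
      \<le> (\<integral>\<^sup>+x. (\<integral>\<^sup>+y. ?t1 x y + ?t2 x y + ?t3 x y + ?t4 x y + ?t5 x y \<partial>lborel) \<partial>lborel)"
    proof (intro nn_integral_mono)
      fix x y :: 'a
      define h where "h = norm (x - y)"
      define K where "K = 1 / h powr (real DIM('a) + 2 * s)"
      have h: "norm (y - x) = h" "h \<ge> 0" by (auto simp: h_def norm_minus_commute)
      have lhs: "ennreal (\<bar>\<phi> x - \<phi> y\<bar>\<^sup>2 / norm (x - y) powr (real DIM('a) + 2 * s)) = ennreal (\<bar>\<phi> x - \<phi> y\<bar>\<^sup>2 * K)"
        by (simp add: K_def h_def)
      show "ennreal (\<bar>\<phi> x - \<phi> y\<bar>\<^sup>2 / norm (x - y) powr (real DIM('a) + 2 * s)) \<le>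
        ?t1 x y + ?t2 x y + ?t3 x y + ?t4 x y + ?t5 x y"
      proof (cases "h < 1")
        case True
        show ?thesis
        proof (cases "(x \<in> \<Omega> \<or> y \<in> \<Omega>) \<and> x \<noteq> y")
          case False
          then have "\<bar>\<phi> x - \<phi> y\<bar> = 0" using \<phi>0 by auto
          then show ?thesis by simp
        next
          case in\<Omega>: True
          then have "h > 0" by (simp add: h_def)
          have "\<bar>\<phi> x - \<phi> y\<bar> \<le> L * h"
            using lipschitz_onD[OF lip, of x y] by (simp add: dist_norm h_def)
          then have "\<bar>\<phi> x - \<phi> y\<bar>\<^sup>2 \<le> L\<^sup>2 * h\<^sup>2"
            using power_mono[of "\<bar>\<phi> x - \<phi> y\<bar>" "L * h" 2] by (simp add: power_mult_distrib)
          then have "\<bar>\<phi> x - \<phi> y\<bar>\<^sup>2 * K \<le> L\<^sup>2 * h\<^sup>2 * K"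
            by (intro mult_right_mono) (auto simp: K_def)
          also have "\<dots> = L\<^sup>2 * h powr (2 - (real DIM('a) + 2 * s))"
            using \<open>h > 0\<close> by (simp add: K_def powr_diff powr_numeral)
          also have "\<dots> \<le> L\<^sup>2 * h powr (- p)"
            using \<open>h > 0\<close> True s by (intro mult_left_mono powr_mono') (auto simp: p_def)
          finally have *: "\<bar>\<phi> x - \<phi> y\<bar>\<^sup>2 * K \<le> L\<^sup>2 * (1 / h powr p)"
            by (simp add: powr_minus_divide)
          have "ennreal (\<bar>\<phi> x - \<phi> y\<bar>\<^sup>2 / norm (x - y) powr (real DIM('a) + 2 * s)) \<le> ennreal (L\<^sup>2) * n (y - x)"
          proof -
            have "n (y - x) = ennreal (1 / h powr p)"
              using True h(1) by (simp add: n_def)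
            then have "ennreal (L\<^sup>2) * n (y - x) = ennreal (L\<^sup>2 * (1 / h powr p))"
              by (simp only: ennreal_mult' zero_le_power2)
            then show ?thesis
              using ennreal_leI[OF *] lhs by (simp only:)
          qed
          also have "\<dots> \<le> ?t1 x y + ?t2 x y"
            using in\<Omega> by (auto simp: indicator_def)
          also have "\<dots> \<le> ?t1 x y + ?t2 x y + (?t3 x y + ?t4 x y + ?t5 x y)"
            by (rule add_increasing2) auto
          finally show ?thesis by (simp only: add.assoc)
        qed
      next
        case False
        have K: "0 \<le> K" "K \<le> 1"
          using False s by (auto simp: K_def divide_simps ge_one_powr_ge_zero)
        have "\<bar>\<phi> x - \<phi> y\<bar>\<^sup>2 = (\<phi> x)\<^sup>2 + (\<phi> y)\<^sup>2 - 2 * \<phi> x * \<phi> y"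
          by (simp add: power2_eq_square algebra_simps)
        also have "\<dots> \<le> (\<phi> x)\<^sup>2 + (\<phi> y)\<^sup>2 + 2 * \<bar>\<phi> x\<bar> * \<bar>\<phi> y\<bar>"
          using abs_ge_minus_self[of "\<phi> x * \<phi> y"] by (simp add: abs_mult)
        finally have "\<bar>\<phi> x - \<phi> y\<bar>\<^sup>2 * K \<le> ((\<phi> x)\<^sup>2 + (\<phi> y)\<^sup>2 + 2 * \<bar>\<phi> x\<bar> * \<bar>\<phi> y\<bar>) * K"
          using K by (intro mult_right_mono)
        \<comment> \<open>The crude bound \<open>K \<le> 1\<close> is spent on the mixed term alone;
          the squares keep \<open>K\<close>, because their integral has to give the sharp
          constant.\<close>
        also have "\<dots> \<le> (\<phi> x)\<^sup>2 * K + (\<phi> y)\<^sup>2 * K + 2 * \<bar>\<phi> x\<bar> * \<bar>\<phi> y\<bar>"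
          using K by (simp add: distrib_right mult_left_le)
        finally have *: "\<bar>\<phi> x - \<phi> y\<bar>\<^sup>2 * K \<le> (\<phi> x)\<^sup>2 * K + (\<phi> y)\<^sup>2 * K + 2 * \<bar>\<phi> x\<bar> * \<bar>\<phi> y\<bar>" .
        have "k (y - x) = ennreal K"
          using False h(1) by (simp add: k_def K_def)
        then have "?t3 x y + ?t4 x y + ?t5 x y = ennreal ((\<phi> x)\<^sup>2 * K + (\<phi> y)\<^sup>2 * K + 2 * \<bar>\<phi> x\<bar> * \<bar>\<phi> y\<bar>)"
          using K by (simp add: ennreal_mult)
        then have "ennreal (\<bar>\<phi> x - \<phi> y\<bar>\<^sup>2 * K) \<le> ?t3 x y + ?t4 x y + ?t5 x y"
          using ennreal_leI[OF *] by (simp only:)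
        moreover have "?t1 x y = 0" "?t2 x y = 0"
          using False h(1) by (simp_all add: n_def)
        ultimately show ?thesis unfolding lhs by (simp only: add_0)
      qed
    qed
    also have "\<dots> = (\<integral>\<^sup>+x. (\<integral>\<^sup>+y. ?t1 x y \<partial>lborel) \<partial>lborel) + (\<integral>\<^sup>+x. (\<integral>\<^sup>+y. ?t2 x y \<partial>lborel) \<partial>lborel) +
       (\<integral>\<^sup>+x. (\<integral>\<^sup>+y. ?t3 x y \<partial>lborel) \<partial>lborel) + (\<integral>\<^sup>+x. (\<integral>\<^sup>+y. ?t4 x y \<partial>lborel) \<partial>lborel) +
       (\<integral>\<^sup>+x. (\<integral>\<^sup>+y. ?t5 x y \<partial>lborel) \<partial>lborel)"
      by (simp add: nn_integral_add)
    also have "(\<integral>\<^sup>+x. (\<integral>\<^sup>+y. ?t1 x y \<partial>lborel) \<partial>lborel) = ennreal (L\<^sup>2) * ennreal m * ennreal \<kappa>"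
      using nn_integral_convolution_fst[of n "\<lambda>x. ennreal (L\<^sup>2) * indicator \<Omega> x"] by (simp add: L\<Omega> \<kappa>(1))
    also have "(\<integral>\<^sup>+x. (\<integral>\<^sup>+y. ?t2 x y \<partial>lborel) \<partial>lborel) = ennreal (L\<^sup>2) * ennreal m * ennreal \<kappa>"
      using nn_integral_convolution_snd[of n "\<lambda>x. ennreal (L\<^sup>2) * indicator \<Omega> x"] by (simp add: L\<Omega> \<kappa>(1) neven)
    also have "(\<integral>\<^sup>+x. (\<integral>\<^sup>+y. ?t3 x y \<partial>lborel) \<partial>lborel) = ennreal ((L2_norm \<Omega> \<phi>)\<^sup>2) * ennreal (c / (2 * s))"
      using nn_integral_convolution_fst[of k "\<lambda>x. ennreal ((\<phi> x)\<^sup>2)"] by (simp add: \<phi>2 k)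
    also have "(\<integral>\<^sup>+x. (\<integral>\<^sup>+y. ?t4 x y \<partial>lborel) \<partial>lborel) = ennreal ((L2_norm \<Omega> \<phi>)\<^sup>2) * ennreal (c / (2 * s))"
      using nn_integral_convolution_snd[of k "\<lambda>x. ennreal ((\<phi> x)\<^sup>2)"] by (simp add: \<phi>2 k keven)
    also have "(\<integral>\<^sup>+x. (\<integral>\<^sup>+y. ?t5 x y \<partial>lborel) \<partial>lborel) = ennreal (2 * b * b)"
      using b(2) by (simp add: nn_integral_cmult nn_integral_multc b ennreal_mult)
    finally have "(\<integral>\<^sup>+x. (\<integral>\<^sup>+y. ennreal (\<bar>\<phi> x - \<phi> y\<bar>\<^sup>2 / norm (x - y) powr (real DIM('a) + 2 * s)) \<partial>lborel) \<partial>lborel)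
       \<le> ennreal (2 * (L\<^sup>2 * m * \<kappa>) + 2 * ((L2_norm \<Omega> \<phi>)\<^sup>2 * (c / (2 * s))) + 2 * b * b)" (is "?I \<le> ennreal ?R")
      using s c b(2) \<kappa>(2) m by (simp add: ennreal_plus[symmetric] ennreal_mult[symmetric] mult_ac add_ac del: ennreal_plus)
    then have "ennreal (s / 2) * ?I \<le> ennreal (s / 2) * ennreal ?R"
      by (rule mult_left_mono) simp
    also have "ennreal (s / 2) * ?I = ennreal s * F_frac \<Omega> s \<phi>"
      unfolding F_frac_eq_lborel ze half mult.assoc ..
    also have "ennreal (s / 2) * ennreal ?R = ennreal (s / 2 * ?R)"
      using s by (intro ennreal_mult'[symmetric]) simp
    \<comment> \<open>The factor \<open>s\<close> cancels the \<open>1 / s\<close> of the far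
      squares; the remaining terms do not depend on \<open>s\<close> and form the constant.\<close>
    also have "s / 2 * ?R = F_zero \<Omega> \<phi> + s * (L\<^sup>2 * m * \<kappa> + b * b)"
      using s by (simp add: F_zero_def c_def field_simps)
    finally show "ennreal s * F_frac \<Omega> s \<phi> \<le> ennreal (F_zero \<Omega> \<phi> + s * (L\<^sup>2 * m * \<kappa> + b * b))" .
  qed
qed

section \<open>Square-integrable functions and weak compactness\<close>

text \<open>This is \<open>L2\<close> over an arbitrary measure, so that weak compactness can be
  argued for abstract finite measure spaces.\<close>

definition square_integrable :: "'a measure \<Rightarrow> ('a \<Rightarrow> real) \<Rightarrow> bool" where
  "square_integrable M f \<longleftrightarrow> f \<in> borel_measurable M \<and> integrable M (\<lambda>x. (f x)\<^sup>2)"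

lemma square_integrable_mult:
  assumes "square_integrable M f" "square_integrable M g"
  shows "integrable M (\<lambda>x. f x * g x)"
proof -
  have [measurable]: "f \<in> borel_measurable M" "g \<in> borel_measurable M"
    and "integrable M (\<lambda>x. (f x)\<^sup>2 + (g x)\<^sup>2)"
    using assms by (auto simp: square_integrable_def)
  then show ?thesis
  proof (rule_tac Bochner_Integration.integrable_bound)
    show "AE x in M. norm (f x * g x) \<le> norm ((f x)\<^sup>2 + (g x)\<^sup>2)"
    proof (rule AE_I2)
      fix x
      have "\<bar>f x\<bar> * \<bar>g x\<bar> + \<bar>f x\<bar> * \<bar>g x\<bar> \<le> (f x)\<^sup>2 + (g x)\<^sup>2"
        using zero_le_power2[of "\<bar>f x\<bar> - \<bar>g x\<bar>"] by (simp add: power2_diff)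
      moreover have "0 \<le> \<bar>f x\<bar> * \<bar>g x\<bar>" by simp
      ultimately show "norm (f x * g x) \<le> norm ((f x)\<^sup>2 + (g x)\<^sup>2)"
        unfolding real_norm_def abs_mult by linarith
    qed
  qed auto
qed

lemma square_integrable_cmult:
  "square_integrable M f \<Longrightarrow> square_integrable M (\<lambda>x. c * f x)"
  by (auto simp: square_integrable_def power_mult_distrib)

lemma square_integrable_add:
  assumes "square_integrable M f" "square_integrable M g"
  shows "square_integrable M (\<lambda>x. f x + g x)"
  using assms square_integrable_mult[OF assms]
  by (auto simp: square_integrable_def power2_sum mult.assoc)

lemma square_integrable_diff:
  assumes "square_integrable M f" "square_integrable M g"
  shows "square_integrable M (\<lambda>x. f x - g x)"
  using square_integrable_add[OF assms(1) square_integrable_cmult[OF assms(2), of "- 1"]] by simp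

lemma square_integrable_bound:
  assumes "square_integrable M f" "g \<in> borel_measurable M" "\<And>x. x \<in> space M \<Longrightarrow> \<bar>g x\<bar> \<le> \<bar>f x\<bar>"
  shows "square_integrable M g" "(LINT x|M. (g x)\<^sup>2) \<le> (LINT x|M. (f x)\<^sup>2)"
proof -
  have le: "(g x)\<^sup>2 \<le> (f x)\<^sup>2" if "x \<in> space M" for x
    using assms(3)[OF that] by (simp add: abs_le_square_iff)
  have "integrable M (\<lambda>x. (g x)\<^sup>2)"
    using assms(1) by (rule_tac Bochner_Integration.integrable_bound[of M "\<lambda>x. (f x)\<^sup>2"])
      (use assms(2) le in \<open>auto simp: square_integrable_def intro!: AE_I2\<close>)
  then show "square_integrable M g" "(LINT x|M. (g x)\<^sup>2) \<le> (LINT x|M. (f x)\<^sup>2)"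
    using assms le by (auto simp: square_integrable_def intro: integral_mono)
qed

text \<open>A triangle inequality for squared distances, from
  \<open>(a + b)\<^sup>2 \<le> 2 * a\<^sup>2 + 2 * b\<^sup>2\<close>. The factor 2 is harmless in
  density arguments and explains the \<open>\<epsilon> / 4\<close> chosen there.\<close>

lemma square_integrable_triangle:
  assumes "square_integrable M f" "square_integrable M g" "square_integrable M h"
  shows "(LINT x|M. (f x - h x)\<^sup>2) \<le> 2 * (LINT x|M. (f x - g x)\<^sup>2) + 2 * (LINT x|M. (g x - h x)\<^sup>2)"
proof -
  have i: "integrable M (\<lambda>x. (f x - h x)\<^sup>2)" "integrable M (\<lambda>x. (f x - g x)\<^sup>2)" "integrable M (\<lambda>x. (g x - h x)\<^sup>2)"
    using square_integrable_diff assms by (auto simp: square_integrable_def)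
  have "(LINT x|M. (f x - h x)\<^sup>2) \<le> (LINT x|M. 2 * (f x - g x)\<^sup>2 + 2 * (g x - h x)\<^sup>2)"
  proof (rule integral_mono)
    fix x
    show "(f x - h x)\<^sup>2 \<le> 2 * (f x - g x)\<^sup>2 + 2 * (g x - h x)\<^sup>2"
      using zero_le_power2[of "(f x - g x) - (g x - h x)"] by (simp add: power2_eq_square algebra_simps)
  qed (use i in auto)
  then show ?thesis using i by simp
qed

lemma integral_Cauchy_Schwarz:
  assumes "square_integrable M f" "square_integrable M g"
  shows "\<bar>LINT x|M. f x * g x\<bar> \<le> sqrt ((LINT x|M. (f x)\<^sup>2) * (LINT x|M. (g x)\<^sup>2))"
proof -
  have [measurable]: "f \<in> borel_measurable M" "g \<in> borel_measurable M"
    and i: "integrable M (\<lambda>x. (f x)\<^sup>2)" "integrable M (\<lambda>x. (g x)\<^sup>2)"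
    using assms by (auto simp: square_integrable_def)
  have ifg: "integrable M (\<lambda>x. \<bar>f x\<bar> * \<bar>g x\<bar>)"
    using square_integrable_mult[OF assms] by (simp add: abs_mult[symmetric])
  have "(\<integral>\<^sup>+x. ennreal \<bar>f x\<bar> * ennreal \<bar>g x\<bar> \<partial>M)\<^sup>2 \<le>
      (\<integral>\<^sup>+x. (ennreal \<bar>f x\<bar>)\<^sup>2 \<partial>M) * (\<integral>\<^sup>+x. (ennreal \<bar>g x\<bar>)\<^sup>2 \<partial>M)"
    by (rule Cauchy_Schwarz_nn_integral) measurable
  also have "(\<integral>\<^sup>+x. ennreal \<bar>f x\<bar> * ennreal \<bar>g x\<bar> \<partial>M) = ennreal (LINT x|M. \<bar>f x\<bar> * \<bar>g x\<bar>)"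
    using nn_integral_eq_integral[OF ifg] by (simp add: ennreal_mult)
  also have "(\<integral>\<^sup>+x. (ennreal \<bar>f x\<bar>)\<^sup>2 \<partial>M) = ennreal (LINT x|M. (f x)\<^sup>2)"
    using nn_integral_eq_integral[OF i(1)] by (simp add: ennreal_power)
  also have "(\<integral>\<^sup>+x. (ennreal \<bar>g x\<bar>)\<^sup>2 \<partial>M) = ennreal (LINT x|M. (g x)\<^sup>2)"
    using nn_integral_eq_integral[OF i(2)] by (simp add: ennreal_power)
  finally have "(LINT x|M. \<bar>f x\<bar> * \<bar>g x\<bar>)\<^sup>2 \<le> (LINT x|M. (f x)\<^sup>2) * (LINT x|M. (g x)\<^sup>2)"
    by (simp add: ennreal_power ennreal_mult[symmetric])
  then have "(LINT x|M. \<bar>f x\<bar> * \<bar>g x\<bar>) \<le> sqrt ((LINT x|M. (f x)\<^sup>2) * (LINT x|M. (g x)\<^sup>2))"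
    by (rule real_le_rsqrt)
  moreover have "\<bar>LINT x|M. f x * g x\<bar> \<le> (LINT x|M. \<bar>f x\<bar> * \<bar>g x\<bar>)"
    using integral_abs_bound[of M "\<lambda>x. f x * g x"] by (simp add: abs_mult)
  ultimately show ?thesis by linarith
qed

lemma integral_mult_bound:
  assumes "square_integrable M f" "square_integrable M g"
    and "(LINT x|M. (f x)\<^sup>2) \<le> a" "(LINT x|M. (g x)\<^sup>2) \<le> b"
  shows "\<bar>LINT x|M. f x * g x\<bar> \<le> sqrt (a * b)"
proof -
  have "(LINT x|M. (f x)\<^sup>2) * (LINT x|M. (g x)\<^sup>2) \<le> a * b"
  proof (rule mult_mono)
    show "0 \<le> a"
      using assms(3) by (rule order_trans[rotated]) simp
  qed (use assms in auto)
  then show ?thesis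
    using integral_Cauchy_Schwarz[OF assms(1,2)] real_sqrt_le_mono order_trans by blast
qed

text \<open>Pointwise approximants with \<open>\<bar>s i x\<bar> \<le> 2 * \<bar>f x\<bar>\<close>
  satisfy \<open>\<bar>f x - s i x\<bar> \<le> 3 * \<bar>f x\<bar>\<close>, so
  \<open>9 * (f x)\<^sup>2\<close> dominates the squared error.\<close>

lemma square_integrable_simple_approx:
  assumes f: "square_integrable M f"
  obtains s where "\<And>i. simple_function M (s i)" "\<And>i. square_integrable M (s i)"
    "(\<lambda>i. LINT x|M. (f x - s i x)\<^sup>2) \<longlonglongrightarrow> 0"
proof -
  have [measurable]: "f \<in> borel_measurable M" and i: "integrable M (\<lambda>x. (f x)\<^sup>2)"
    using f by (auto simp: square_integrable_def)
  obtain s where s: "\<And>i. simple_function M (s i)" "\<And>x. x \<in> space M \<Longrightarrow> (\<lambda>i. s i x) \<longlonglongrightarrow> f x"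
      "\<And>i x. x \<in> space M \<Longrightarrow> norm (s i x) \<le> 2 * norm (f x)"
    using borel_measurable_implies_sequence_metric[of f M 0] unfolding norm_conv_dist by (metis \<open>f \<in> borel_measurable M\<close>)
  have [measurable]: "s i \<in> borel_measurable M" for i
    using s(1) by (rule borel_measurable_simple_function)
  have si: "square_integrable M (s i)" for i
    by (rule square_integrable_bound(1)[OF square_integrable_cmult[OF f, of 2]]) (use s(3) in \<open>auto simp: abs_mult\<close>)
  have "(\<lambda>i. LINT x|M. (f x - s i x)\<^sup>2) \<longlonglongrightarrow> (LINT x|M. 0)"
  proof (rule integral_dominated_convergence[where w="\<lambda>x. 9 * (f x)\<^sup>2"])
    show "AE x in M. (\<lambda>i. (f x - s i x)\<^sup>2) \<longlonglongrightarrow> 0"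
    proof (rule AE_I2)
      fix x assume "x \<in> space M"
      then have "(\<lambda>i. (f x - s i x)\<^sup>2) \<longlonglongrightarrow> (f x - f x)\<^sup>2"
        by (intro tendsto_intros s(2))
      then show "(\<lambda>i. (f x - s i x)\<^sup>2) \<longlonglongrightarrow> 0" by simp
    qed
    show "AE x in M. norm ((f x - s i x)\<^sup>2) \<le> 9 * (f x)\<^sup>2" for i
    proof (rule AE_I2)
      fix x assume "x \<in> space M"
      then have "\<bar>f x - s i x\<bar> \<le> \<bar>3 * f x\<bar>"
        using s(3)[of x i] by auto
      then have "(f x - s i x)\<^sup>2 \<le> (3 * f x)\<^sup>2"
        by (simp only: abs_le_square_iff)
      then show "norm ((f x - s i x)\<^sup>2) \<le> 9 * (f x)\<^sup>2" by (simp add: power_mult_distrib)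
    qed
  qed (use i in auto)
  then show ?thesis using that[OF s(1) si] by simp
qed

section \<open>Finite measures and weak limits\<close>

lemma (in finite_measure) square_integrable_bounded:
  fixes f :: "'a \<Rightarrow> real"
  assumes "f \<in> borel_measurable M" "\<And>x. x \<in> space M \<Longrightarrow> \<bar>f x\<bar> \<le> B"
  shows "square_integrable M f"
proof -
  have "square_integrable M (\<lambda>_. B)" by (simp add: square_integrable_def)
  then show ?thesis
    by (rule square_integrable_bound(1)) (use assms order_trans abs_ge_self in \<open>blast+\<close>)
qed

lemma (in finite_measure) square_integrable_simple_function:
  fixes f :: "'a \<Rightarrow> real"
  assumes "simple_function M f"
  shows "square_integrable M f"
proof -
  have "finite (f ` space M)" using assms by (rule simple_functionD)
  then obtain B where "\<And>x. x \<in> space M \<Longrightarrow> \<bar>f x\<bar> \<le> B"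
    using finite_imp_bounded[of "f ` space M"] by (auto simp: bounded_iff)
  then show ?thesis
    using assms by (intro square_integrable_bounded borel_measurable_simple_function)
qed

lemma (in finite_measure) square_integrable_indicator:
  "A \<in> sets M \<Longrightarrow> square_integrable M (indicator A)"
  by (rule square_integrable_bounded[of _ 1]) (auto simp: indicator_def)

lemma (in finite_measure) integral_mult_indicator_bound:
  assumes "square_integrable M f" "(LINT x|M. (f x)\<^sup>2) \<le> B" "A \<in> sets M"
  shows "\<bar>LINT x|M. f x * indicator A x\<bar> \<le> sqrt (B * measure M A)"
proof (rule integral_mult_bound[OF assms(1) square_integrable_indicator[OF assms(3)] assms(2)])
  have "(LINT x|M. (indicator A x)\<^sup>2) = (LINT x|M. indicator A x :: real)"
    by (intro Bochner_Integration.integral_cong) (auto simp: indicator_def)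
  then show "(LINT x|M. (indicator A x)\<^sup>2) \<le> measure M A"
    using assms(3) by simp
qed

text \<open>Induction for nonnegative simple functions applies to the positive and the negative
  part; closure under multiples by any real \<open>c\<close>, here \<open>- 1\<close>, allows
  subtracting the two.\<close>

lemma simple_function_induct_real_signed [consumes 1, case_names cong set mult add]:
  fixes u :: "'a \<Rightarrow> real"
  assumes u: "simple_function M u"
    and cong: "\<And>f g. simple_function M f \<Longrightarrow> simple_function M g \<Longrightarrow> (AE x in M. f x = g x) \<Longrightarrow> P f \<Longrightarrow> P g"
    and set: "\<And>A. A \<in> sets M \<Longrightarrow> P (indicator A)"
    and mult: "\<And>u c. P u \<Longrightarrow> P (\<lambda>x. c * u x)"
    and add: "\<And>u v. P u \<Longrightarrow> P v \<Longrightarrow> P (\<lambda>x. u x + v x)"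
  shows "P u"
proof -
  have nonneg: "P v" if "simple_function M v" "\<And>x. v x \<ge> 0" for v
  proof (rule simple_function_induct_real[of M v P])
    show "P g" if "simple_function M f" "simple_function M g" "AE x in M. f x = g x" "P f" for f g
      using that by (rule cong)
  qed (use that set mult add in blast)+
  have "P (\<lambda>x. max (u x) 0)"
    using simple_function_compose1[OF u, of "\<lambda>y. max y 0"] by (rule nonneg) simp
  moreover have "P (\<lambda>x. max (- u x) 0)"
    using simple_function_compose1[OF u, of "\<lambda>y. max (- y) 0"] by (rule nonneg) simp
  ultimately have "P (\<lambda>x. max (u x) 0 + (- 1) * max (- u x) 0)"
    by (intro add mult)
  also have "(\<lambda>x. max (u x) 0 + (- 1) * max (- u x) 0) = u"
    by auto
  finally show ?thesis .
qed

text \<open>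
  Neither completeness of \<open>L\<^sup>2\<close> nor the Riesz representation theorem is needed: along a subsequence the
  set functions \<open>A \<mapsto> \<integral>\<^sub>A f\<^sub>n\<close> converge, first on \<open>\<D>\<close> and then, since they are uniformly bounded by
  \<open>(B \<bar>A\<bar>)\<^sup>1\<^sup>/\<^sup>2\<close>, on all measurable sets; the same bound makes the limit a measure, and its
  Radon--Nikodym density is the weak limit.
\<close>

lemma (in finite_measure) weak_compactness_nonneg:
  fixes f :: "nat \<Rightarrow> 'a \<Rightarrow> real"
  assumes D: "countable \<D>" "\<D> \<subseteq> sets M"
    and dense: "\<And>A \<epsilon>. A \<in> sets M \<Longrightarrow> \<epsilon> > 0 \<Longrightarrow> \<exists>D\<in>\<D>. measure M (sym_diff A D) < \<epsilon>"
    and f: "\<And>n. square_integrable M (f n)" "\<And>n x. 0 \<le> f n x" "\<And>n. (LINT x|M. (f n x)\<^sup>2) \<le> B"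
  obtains r w where "strict_mono r" "square_integrable M w"
    "\<And>\<phi>. square_integrable M \<phi> \<Longrightarrow> (\<lambda>n. LINT x|M. f (r n) x * \<phi> x) \<longlonglongrightarrow> (LINT x|M. w x * \<phi> x)"
proof -
  have B: "B \<ge> 0" using f(3)[of 0] by (rule order_trans[rotated]) simp
  have [measurable]: "f n \<in> borel_measurable M" for n
    using f(1)[of n] by (simp add: square_integrable_def)
  define F where "F = (\<lambda>n A. LINT x|M. f n x * indicator A x)"
  have int: "integrable M (\<lambda>x. f n x * indicator A x)" if "A \<in> sets M" for n A
    using square_integrable_mult[OF f(1) square_integrable_indicator[OF that]] .
  have F0: "0 \<le> F n A" for n A
    unfolding F_def by (intro Bochner_Integration.integral_nonneg) (auto simp: f(2))
  have Fb: "F n A \<le> sqrt (B * measure M A)" if "A \<in> sets M" for n A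
    using integral_mult_indicator_bound[OF f(1)[of n] f(3)[of n] that] unfolding F_def by linarith
  have Fadd: "F n (A \<union> C) = F n A + F n C" if "A \<in> sets M" "C \<in> sets M" "A \<inter> C = {}" for n A C
  proof -
    have "F n (A \<union> C) = (LINT x|M. f n x * indicator A x + f n x * indicator C x)"
      unfolding F_def using that(3) by (intro Bochner_Integration.integral_cong) (auto simp: indicator_def)
    then show ?thesis using int that by (simp add: F_def)
  qed
  have Fdiff: "\<bar>F n A - F n C\<bar> \<le> F n (sym_diff A C)" if "A \<in> sets M" "C \<in> sets M" for n A C
  proof -
    have "F n A - F n C = (LINT x|M. f n x * indicator A x - f n x * indicator C x)"
      using int that by (simp add: F_def)
    also have "\<bar>\<dots>\<bar> \<le> (LINT x|M. \<bar>f n x * indicator A x - f n x * indicator C x\<bar>)"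
      by (rule integral_abs_bound)
    also have "\<dots> = F n (sym_diff A C)"
      unfolding F_def using f(2) by (intro Bochner_Integration.integral_cong) (auto simp: indicator_def)
    finally show ?thesis .
  qed
  have "norm (F n A) \<le> sqrt (B * measure M (space M))" if "A \<in> \<D>" for n A
  proof -
    have "F n A \<le> sqrt (B * measure M A)" "B * measure M A \<le> B * measure M (space M)"
      using that D(2) B by (auto intro!: Fb mult_left_mono bounded_measure)
    then have "F n A \<le> sqrt (B * measure M (space M))"
      by (meson order_trans real_sqrt_le_mono)
    then show ?thesis
      using F0[of n A] by simp
  qed
  \<comment> \<open>Cantor diagonal extraction: countably many bounded real sequences converge along
    a common subsequence.\<close>
  from function_convergent_subsequence[OF D(1), of F, OF this]
  obtain r where r: "strict_mono (r::nat\<Rightarrow>nat)" "\<And>A. A \<in> \<D> \<Longrightarrow> \<exists>l. (\<lambda>n. F (r n) A) \<longlonglongrightarrow> l"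
    by blast
  have conv: "convergent (\<lambda>n. F (r n) A)" if A: "A \<in> sets M" for A
  proof (rule Cauchy_convergent, rule metric_CauchyI)
    fix \<epsilon> :: real assume \<epsilon>: "\<epsilon> > 0"
    \<comment> \<open>The threshold makes \<open>sqrt (B * measure M (sym_diff A C))\<close> smaller
      than \<open>\<epsilon> / 3\<close>; dividing by \<open>B + 1\<close> also covers
      \<open>B = 0\<close>.\<close>
    have "0 < (\<epsilon> / 3)\<^sup>2 / (B + 1)" using \<epsilon> B by simp
    from dense[OF A this] obtain C where C: "C \<in> \<D>" "measure M (sym_diff A C) < (\<epsilon> / 3)\<^sup>2 / (B + 1)"
      by blast
    have CM: "C \<in> sets M" using C D by auto
    have "B * measure M (sym_diff A C) \<le> (B + 1) * measure M (sym_diff A C)"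
      by (rule mult_right_mono) auto
    also have "\<dots> < (\<epsilon> / 3)\<^sup>2"
      using C(2) B by (simp add: field_simps)
    finally have small: "sqrt (B * measure M (sym_diff A C)) < \<epsilon> / 3"
      using \<epsilon> by (intro real_less_lsqrt) auto
    have close: "\<bar>F n A - F n C\<bar> < \<epsilon> / 3" for n
    proof -
      have "sym_diff A C \<in> sets M" using A CM by auto
      from Fb[OF this, of n] show ?thesis
        using Fdiff[OF A CM, of n] small by linarith
    qed
    have "Cauchy (\<lambda>n. F (r n) C)"
      using r(2)[OF C(1)] by (auto intro: convergent_Cauchy convergentI)
    then obtain N where N: "\<And>m n. m \<ge> N \<Longrightarrow> n \<ge> N \<Longrightarrow> dist (F (r m) C) (F (r n) C) < \<epsilon> / 3"
      using metric_CauchyD[of "\<lambda>n. F (r n) C" "\<epsilon> / 3"] \<epsilon> by auto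
    show "\<exists>N. \<forall>m\<ge>N. \<forall>n\<ge>N. dist (F (r m) A) (F (r n) A) < \<epsilon>"
    proof (intro exI allI impI)
      fix m n assume "m \<ge> N" "n \<ge> N"
      then show "dist (F (r m) A) (F (r n) A) < \<epsilon>"
        using N[of m n] close[of "r m"] close[of "r n"] unfolding dist_real_def by linarith
    qed
  qed
  define G where "G = (\<lambda>A. lim (\<lambda>n. F (r n) A))"
  have G: "(\<lambda>n. F (r n) A) \<longlonglongrightarrow> G A" if "A \<in> sets M" for A
    using conv[OF that] unfolding G_def by (simp add: convergent_LIMSEQ_iff)
  have G0: "0 \<le> G A" if "A \<in> sets M" for A
    using G[OF that] F0 by (intro LIMSEQ_le_const) auto
  have Gb: "G A \<le> sqrt (B * measure M A)" if "A \<in> sets M" for A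
    using G[OF that] Fb[OF that] by (intro LIMSEQ_le_const2) auto
  have Gadd: "G (A \<union> C) = G A + G C" if "A \<in> sets M" "C \<in> sets M" "A \<inter> C = {}" for A C
  proof (rule LIMSEQ_unique)
    show "(\<lambda>n. F (r n) (A \<union> C)) \<longlonglongrightarrow> G (A \<union> C)" using that by (intro G) auto
    show "(\<lambda>n. F (r n) (A \<union> C)) \<longlonglongrightarrow> G A + G C"
      using that by (simp add: Fadd) (intro tendsto_add G that)
  qed
  define N where "N = measure_of (space M) (sets M) (\<lambda>A. ennreal (G A))"
  have setsN: "sets N = sets M"
    by (simp add: N_def)
  have pos: "positive (sets M) (\<lambda>A. ennreal (G A))"
    using Gb[of "{}"] by (auto simp: positive_def ennreal_eq_0_iff)
  have "countably_additive (sets M) (\<lambda>A. ennreal (G A))"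
  \<comment> \<open>For a finite additive set function, continuity along sequences decreasing to the
    empty set suffices; \<open>Gb\<close> transfers it from \<open>M\<close> to
    \<open>G\<close>.\<close>
  proof (rule sets.empty_continuous_imp_countably_additive[OF pos])
    show "additive (sets M) (\<lambda>A. ennreal (G A))"
      using G0 by (auto simp: additive_def Gadd)
    fix A :: "nat \<Rightarrow> 'a set" assume A: "range A \<subseteq> sets M" "decseq A" "(\<Inter>i. A i) = {}"
    have "(\<lambda>i. sqrt (B * measure M (A i))) \<longlonglongrightarrow> sqrt (B * measure M (\<Inter>i. A i))"
      using A by (intro tendsto_intros finite_Lim_measure_decseq)
    then have "(\<lambda>i. sqrt (B * measure M (A i))) \<longlonglongrightarrow> 0" by (simp add: A(3))
    moreover have "\<forall>\<^sub>F i in sequentially. 0 \<le> G (A i)" "\<forall>\<^sub>F i in sequentially. G (A i) \<le> sqrt (B * measure M (A i))"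
      using A(1) G0 Gb by auto
    ultimately have "(\<lambda>i. G (A i)) \<longlonglongrightarrow> 0"
      by (rule tendsto_sandwich[OF _ _ tendsto_const, rotated 2])
    then show "(\<lambda>i. ennreal (G (A i))) \<longlonglongrightarrow> 0"
      by (metis ennreal_0 tendsto_ennrealI)
  qed auto
  then have emN: "emeasure N A = ennreal (G A)" if "A \<in> sets M" for A
    using emeasure_measure_of_sigma[OF sets.sigma_algebra_axioms pos _ that] by (simp add: N_def)
  have "absolutely_continuous M N"
    unfolding absolutely_continuous_def
  proof (rule subsetI)
    fix A assume "A \<in> null_sets M"
    then have "A \<in> sets M" "measure M A = 0" by (auto simp: measure_def)
    then show "A \<in> null_sets N"
      using Gb[of A] by (auto simp: null_sets_def setsN emN ennreal_eq_0_iff)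
  qed
  then obtain g where g [measurable]: "g \<in> borel_measurable M" and dens: "density M g = N"
    using Radon_Nikodym setsN by blast
  have gA: "(\<integral>\<^sup>+x. g x * indicator A x \<partial>M) = ennreal (G A)" if "A \<in> sets M" for A
    using that emN[OF that] emeasure_density[OF g that] by (simp add: dens)
  \<comment> \<open>The density takes values in \<open>ennreal\<close>. Its total mass
    \<open>G (space M)\<close> is finite, so the real-valued version \<open>w\<close> agrees with it
    almost everywhere.\<close>
  have "AE x in M. g x \<noteq> \<infinity>"
  proof (rule nn_integral_PInf_AE[OF g])
    have "(\<integral>\<^sup>+x. g x \<partial>M) = (\<integral>\<^sup>+x. g x * indicator (space M) x \<partial>M)"
      by (intro nn_integral_cong) auto
    also have "\<dots> = ennreal (G (space M))" by (rule gA) simp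
    finally show "(\<integral>\<^sup>+x. g x \<partial>M) \<noteq> \<infinity>" by simp
  qed
  define w where "w = (\<lambda>x. enn2real (g x))"
  have [measurable]: "w \<in> borel_measurable M" unfolding w_def by measurable
  have w0: "0 \<le> w x" for x by (simp add: w_def)
  have wg: "AE x in M. ennreal (w x) = g x"
    using \<open>AE x in M. g x \<noteq> \<infinity>\<close> by eventually_elim (auto simp: w_def less_top)
  have wA: "integrable M (\<lambda>x. w x * indicator A x)" "(LINT x|M. w x * indicator A x) = G A" if A: "A \<in> sets M" for A
  proof -
    have "(\<integral>\<^sup>+x. ennreal (w x * indicator A x) \<partial>M) = (\<integral>\<^sup>+x. g x * indicator A x \<partial>M)"
      using wg by (intro nn_integral_cong_AE) (auto elim!: eventually_mono simp: indicator_def)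
    then have *: "(\<integral>\<^sup>+x. ennreal (w x * indicator A x) \<partial>M) = ennreal (G A)"
      by (simp add: gA[OF A])
    have "has_bochner_integral M (\<lambda>x. w x * indicator A x) (G A)"
      using * A G0[OF A] by (intro has_bochner_integral_nn_integral) (auto simp: w0)
    then show "integrable M (\<lambda>x. w x * indicator A x)" "(LINT x|M. w x * indicator A x) = G A"
      by (auto simp: has_bochner_integral_iff)
  qed
  \<comment> \<open>The integrability clauses travel along because the case of sums needs additivity
    of the integrals. The membership of \<open>w\<close> in the square-integrable functions is not
    known yet.\<close>
  have simple: "integrable M (\<lambda>x. w x * \<phi> x) \<and> (\<forall>n. integrable M (\<lambda>x. f n x * \<phi> x)) \<and>
      (\<lambda>n. LINT x|M. f (r n) x * \<phi> x) \<longlonglongrightarrow> (LINT x|M. w x * \<phi> x)" if "simple_function M \<phi>" for \<phi>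
    using that
  proof (induction rule: simple_function_induct_real_signed)
    case (cong \<phi> \<psi>)
    have [measurable]: "\<phi> \<in> borel_measurable M" "\<psi> \<in> borel_measurable M"
      using cong by (auto intro: borel_measurable_simple_function)
    have ae: "AE x in M. h x * \<phi> x = h x * \<psi> x" for h
      using cong(3) by eventually_elim simp
    have "integrable M (\<lambda>x. h x * \<phi> x) = integrable M (\<lambda>x. h x * \<psi> x)"
      if [measurable]: "h \<in> borel_measurable M" for h
      by (rule integrable_cong_AE[OF _ _ ae]) measurable
    moreover have "(LINT x|M. h x * \<phi> x) = (LINT x|M. h x * \<psi> x)"
      if [measurable]: "h \<in> borel_measurable M" for h
      by (rule integral_cong_AE[OF _ _ ae]) measurable
    ultimately show ?case using cong(4) by simp
  next
    case (set A)
    then show ?case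
      using wA[OF set] G[OF set] int[OF set] by (simp add: F_def)
  next
    case (mult \<phi> c)
    then show ?case
      by (auto simp: mult.left_commute intro: tendsto_mult_left)
  next
    case (add \<phi> \<psi>)
    then show ?case
      by (auto simp: distrib_left intro: tendsto_add)
  qed
  \<comment> \<open>A duality argument: for simple functions \<open>s i\<close> increasing to
    \<open>w\<close>, the integral \<open>q\<close> of \<open>(s i)\<^sup>2\<close> is at most that
    of \<open>w * s i\<close>. The latter is a limit of integrals of \<open>f (r n) * s i\<close>,
    each at most \<open>sqrt (B * q)\<close>. Hence \<open>q \<le> B\<close>, and Fatou passes this
    bound to \<open>w\<close>.\<close>
  have w: "square_integrable M w" "(LINT x|M. (w x)\<^sup>2) \<le> B"
  proof -
    obtain s where s: "incseq s" "\<And>i. simple_function M (s i)" "\<And>x. bdd_above (range (\<lambda>i. s i x))"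
        "\<And>i x. (0::real) \<le> s i x" "w = (SUP i. s i)"
      using borel_measurable_implies_simple_function_sequence_real[of w M] w0 by auto
    have lim: "(\<lambda>i. s i x) \<longlonglongrightarrow> w x" for x
    proof -
      have "(\<lambda>i. s i x) \<longlonglongrightarrow> (SUP i. s i x)"
        using s(1,3) by (intro LIMSEQ_incseq_SUP) (auto simp: incseq_def le_fun_def)
      then show ?thesis by (simp add: s(5) image_comp)
    qed
    have le: "s i x \<le> w x" for i x
      using s(1) by (intro incseq_le[OF _ lim]) (auto simp: incseq_def le_fun_def)
    have [measurable]: "s i \<in> borel_measurable M" for i
      using s(2) by (rule borel_measurable_simple_function)
    have sb: "(LINT x|M. (s i x)\<^sup>2) \<le> B" for i
    proof -
      let ?q = "LINT x|M. (s i x)\<^sup>2"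
      have si: "square_integrable M (s i)" using s(2) by (rule square_integrable_simple_function)
      have "?q \<le> (LINT x|M. w x * s i x)"
        using si simple[OF s(2)] le s(4)
        by (intro integral_mono) (auto simp: square_integrable_def power2_eq_square intro!: mult_right_mono)
      also have "\<dots> \<le> sqrt (B * ?q)"
      proof (rule LIMSEQ_le_const2)
        show "(\<lambda>n. LINT x|M. f (r n) x * s i x) \<longlonglongrightarrow> (LINT x|M. w x * s i x)"
          using simple[OF s(2)] by blast
        show "\<exists>N. \<forall>n\<ge>N. (LINT x|M. f (r n) x * s i x) \<le> sqrt (B * ?q)"
          using integral_mult_bound[OF f(1) si f(3) order_refl] by (auto intro: order_trans[OF abs_ge_self])
      qed
      finally have q: "?q \<le> sqrt (B * ?q)" .
      have q0: "0 \<le> ?q" by simp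
      have "?q\<^sup>2 \<le> (sqrt (B * ?q))\<^sup>2"
        using q q0 by (rule power_mono)
      also have "\<dots> = B * ?q"
        using B q0 by (intro real_sqrt_pow2 mult_nonneg_nonneg)
      finally have "?q * ?q \<le> B * ?q"
        by (simp only: power2_eq_square)
      then show ?thesis
      proof (cases "?q = 0")
        case True
        then show ?thesis using B by (simp only:)
      next
        case False
        then have "0 < ?q" using q0 by linarith
        then show ?thesis using \<open>?q * ?q \<le> B * ?q\<close> by (rule mult_right_le_imp_le[rotated])
      qed
    qed
    have "(\<integral>\<^sup>+x. ennreal ((w x)\<^sup>2) \<partial>M) = (\<integral>\<^sup>+x. liminf (\<lambda>i. ennreal ((s i x)\<^sup>2)) \<partial>M)"
    proof (rule nn_integral_cong)
      fix x
      have "(\<lambda>i. ennreal ((s i x)\<^sup>2)) \<longlonglongrightarrow> ennreal ((w x)\<^sup>2)"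
        by (intro tendsto_ennrealI tendsto_intros lim)
      then show "ennreal ((w x)\<^sup>2) = liminf (\<lambda>i. ennreal ((s i x)\<^sup>2))"
        by (intro lim_imp_Liminf[symmetric]) auto
    qed
    also have "\<dots> \<le> liminf (\<lambda>i. \<integral>\<^sup>+x. ennreal ((s i x)\<^sup>2) \<partial>M)"
      by (rule nn_integral_liminf) measurable
    also have "\<dots> \<le> ennreal B"
    proof -
      have "(\<integral>\<^sup>+x. ennreal ((s i x)\<^sup>2) \<partial>M) \<le> ennreal B" for i
        using sb[of i] square_integrable_simple_function[OF s(2)[of i]]
        by (simp add: square_integrable_def nn_integral_eq_integral ennreal_leI)
      then show ?thesis by (intro Liminf_le) auto
    qed
    finally have nn: "(\<integral>\<^sup>+x. ennreal ((w x)\<^sup>2) \<partial>M) \<le> ennreal B" .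
    have iw: "integrable M (\<lambda>x. (w x)\<^sup>2)"
      using nn by (intro integrableI_nonneg) (auto intro: le_less_trans)
    then show "square_integrable M w" by (simp add: square_integrable_def)
    show "(LINT x|M. (w x)\<^sup>2) \<le> B"
      using nn B by (simp add: nn_integral_eq_integral[OF iw])
  qed
  have "(\<lambda>n. LINT x|M. f (r n) x * \<phi> x) \<longlonglongrightarrow> (LINT x|M. w x * \<phi> x)" if \<phi>: "square_integrable M \<phi>" for \<phi>
  proof (rule LIMSEQ_I)
    fix \<epsilon> :: real assume \<epsilon>: "\<epsilon> > 0"
    obtain s where s: "\<And>i. simple_function M (s i)" "\<And>i. square_integrable M (s i)"
        "(\<lambda>i. LINT x|M. (\<phi> x - s i x)\<^sup>2) \<longlonglongrightarrow> 0"
      using square_integrable_simple_approx[OF \<phi>] by blast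
    have "(\<lambda>i. sqrt (B * (LINT x|M. (\<phi> x - s i x)\<^sup>2))) \<longlonglongrightarrow> sqrt (B * 0)"
      by (intro tendsto_intros s(3))
    then have "\<forall>\<^sub>F i in sequentially. sqrt (B * (LINT x|M. (\<phi> x - s i x)\<^sup>2)) < \<epsilon> / 3"
      using \<epsilon> by (intro order_tendstoD(2)) auto
    then obtain i where i: "sqrt (B * (LINT x|M. (\<phi> x - s i x)\<^sup>2)) < \<epsilon> / 3"
      by (auto simp: eventually_sequentially)
    \<comment> \<open>This error estimate is uniform over all \<open>h\<close> with squared norm at
      most \<open>B\<close>. It is applied to every \<open>f (r n)\<close> and to \<open>w\<close>,
      which is why the bound on \<open>w\<close> was established along with its square
      integrability.\<close>
    have approx: "\<bar>(LINT x|M. h x * \<phi> x) - (LINT x|M. h x * s i x)\<bar> < \<epsilon> / 3"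
      if h: "square_integrable M h" "(LINT x|M. (h x)\<^sup>2) \<le> B" for h
    proof -
      have "(LINT x|M. h x * \<phi> x) - (LINT x|M. h x * s i x) = (LINT x|M. h x * (\<phi> x - s i x))"
        using square_integrable_mult[OF h(1) \<phi>] square_integrable_mult[OF h(1) s(2)[of i]]
        by (simp add: right_diff_distrib)
      then show ?thesis
        using integral_mult_bound[OF h(1) square_integrable_diff[OF \<phi> s(2)[of i]] h(2) order_refl] i
        by (simp only:)
    qed
    have "(\<lambda>n. LINT x|M. f (r n) x * s i x) \<longlonglongrightarrow> (LINT x|M. w x * s i x)" "0 < \<epsilon> / 3"
      using simple[OF s(1)[of i]] \<epsilon> by auto
    from LIMSEQ_D[OF this] obtain n0 where
      n0: "\<And>n. n \<ge> n0 \<Longrightarrow> \<bar>(LINT x|M. f (r n) x * s i x) - (LINT x|M. w x * s i x)\<bar> < \<epsilon> / 3"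
      by (auto simp only: real_norm_def)
    show "\<exists>no. \<forall>n\<ge>no. norm ((LINT x|M. f (r n) x * \<phi> x) - (LINT x|M. w x * \<phi> x)) < \<epsilon>"
    proof (intro exI[of _ n0] allI impI)
      fix n assume "n \<ge> n0"
      then show "norm ((LINT x|M. f (r n) x * \<phi> x) - (LINT x|M. w x * \<phi> x)) < \<epsilon>"
        using approx[OF f(1) f(3), of "r n"] approx[OF w] n0[of n] unfolding real_norm_def by linarith
    qed
  qed
  then show ?thesis using that[OF r(1) w(1)] by blast
qed

text \<open>The limit set function is a measure only for nonnegative functions, so positive and
  negative parts are treated separately. Both are dominated by \<open>\<bar>f n\<bar>\<close> and
  keep the bound \<open>B\<close>; the second subsequence is extracted from the first, along which
  \<open>p\<close> still converges.\<close>

lemma (in finite_measure) weak_compactness: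
  fixes f :: "nat \<Rightarrow> 'a \<Rightarrow> real"
  assumes D: "countable \<D>" "\<D> \<subseteq> sets M"
    and dense: "\<And>A \<epsilon>. A \<in> sets M \<Longrightarrow> \<epsilon> > 0 \<Longrightarrow> \<exists>D\<in>\<D>. measure M (sym_diff A D) < \<epsilon>"
    and f: "\<And>n. square_integrable M (f n)" "\<And>n. (LINT x|M. (f n x)\<^sup>2) \<le> B"
  obtains r w where "strict_mono r" "square_integrable M w"
    "\<And>\<phi>. square_integrable M \<phi> \<Longrightarrow> (\<lambda>n. LINT x|M. f (r n) x * \<phi> x) \<longlonglongrightarrow> (LINT x|M. w x * \<phi> x)"
proof -
  define p where "p = (\<lambda>n x. max (f n x) 0)"
  define q where "q = (\<lambda>n x. max (- f n x) 0)"
  have [measurable]: "f n \<in> borel_measurable M" for n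
    using f(1)[of n] by (simp add: square_integrable_def)
  have p: "square_integrable M (p n)" "(LINT x|M. (p n x)\<^sup>2) \<le> B" for n
  proof -
    have m: "p n \<in> borel_measurable M" unfolding p_def by measurable
    have "\<bar>p n x\<bar> \<le> \<bar>f n x\<bar>" for x by (auto simp: p_def)
    then show "square_integrable M (p n)" "(LINT x|M. (p n x)\<^sup>2) \<le> B"
      using square_integrable_bound[OF f(1) m] f(2)[of n] by (blast, meson order_trans)
  qed
  have q: "square_integrable M (q n)" "(LINT x|M. (q n x)\<^sup>2) \<le> B" for n
  proof -
    have m: "q n \<in> borel_measurable M" unfolding q_def by measurable
    have "\<bar>q n x\<bar> \<le> \<bar>f n x\<bar>" for x by (auto simp: q_def)
    then show "square_integrable M (q n)" "(LINT x|M. (q n x)\<^sup>2) \<le> B"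
      using square_integrable_bound[OF f(1) m] f(2)[of n] by (blast, meson order_trans)
  qed
  have nonneg: "0 \<le> p n x" "0 \<le> q n x" for n x by (auto simp: p_def q_def)
  obtain r w where r: "strict_mono r" and w: "square_integrable M w"
    "\<And>\<phi>. square_integrable M \<phi> \<Longrightarrow> (\<lambda>n. LINT x|M. p (r n) x * \<phi> x) \<longlonglongrightarrow> (LINT x|M. w x * \<phi> x)"
    using weak_compactness_nonneg[of \<D> p B, OF D dense p(1) nonneg(1) p(2)] by blast
  obtain r' w' where r': "strict_mono r'" and w': "square_integrable M w'"
    "\<And>\<phi>. square_integrable M \<phi> \<Longrightarrow> (\<lambda>n. LINT x|M. q (r (r' n)) x * \<phi> x) \<longlonglongrightarrow> (LINT x|M. w' x * \<phi> x)"
    using weak_compactness_nonneg[of \<D> "\<lambda>n. q (r n)" B, OF D dense q(1) nonneg(2) q(2)] by blast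
  show ?thesis
  proof (rule that[of "r \<circ> r'" "\<lambda>x. w x - w' x"])
    show "strict_mono (r \<circ> r')" using r r' by (rule strict_mono_o)
    show "square_integrable M (\<lambda>x. w x - w' x)" using w w' by (intro square_integrable_diff)
    fix \<phi> assume \<phi>: "square_integrable M \<phi>"
    have "f n x = p n x - q n x" for n x by (auto simp: p_def q_def)
    then have "(LINT x|M. f n x * \<phi> x) = (LINT x|M. p n x * \<phi> x) - (LINT x|M. q n x * \<phi> x)" for n
      using square_integrable_mult[OF p(1)[of n] \<phi>] square_integrable_mult[OF q(1)[of n] \<phi>]
      by (simp add: left_diff_distrib)
    moreover have "(LINT x|M. (w x - w' x) * \<phi> x) = (LINT x|M. w x * \<phi> x) - (LINT x|M. w' x * \<phi> x)"
      using square_integrable_mult[OF w(1) \<phi>] square_integrable_mult[OF w'(1) \<phi>]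
      by (simp add: left_diff_distrib)
    moreover have "(\<lambda>n. (LINT x|M. p (r (r' n)) x * \<phi> x) - (LINT x|M. q (r (r' n)) x * \<phi> x)) \<longlonglongrightarrow>
        (LINT x|M. w x * \<phi> x) - (LINT x|M. w' x * \<phi> x)"
      using LIMSEQ_subseq_LIMSEQ[OF w(2)[OF \<phi>] r'] by (intro tendsto_diff w'(2)[OF \<phi>]) (simp add: o_def)
    ultimately show "(\<lambda>n. LINT x|M. f ((r \<circ> r') n) x * \<phi> x) \<longlonglongrightarrow> (LINT x|M. (w x - w' x) * \<phi> x)"
      by simp
  qed
qed

section \<open>Density results on bounded open sets\<close>

lemma finite_measure_lebesgue_on:
  assumes "\<Omega> \<in> lmeasurable"
  shows "finite_measure (lebesgue_on \<Omega>)"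
  using assms by (intro finite_measureI) (auto simp: emeasure_restrict_space fmeasurable_def)

lemma sets_lebesgue_on_iff:
  assumes "\<Omega> \<in> sets lebesgue"
  shows "A \<in> sets (lebesgue_on \<Omega>) \<longleftrightarrow> A \<subseteq> \<Omega> \<and> A \<in> sets lebesgue"
  using assms by (intro sets_restrict_space_iff) auto

text \<open>A measurable set is close to an open one by outer regularity, an open set is a countable
  union of basis sets, and finite subunions exhaust it in measure. A countable basis has only
  countably many finite subfamilies.\<close>

lemma countable_dense_sets_lebesgue_on:
  fixes \<Omega> :: "'a::euclidean_space set"
  assumes "open \<Omega>" "bounded \<Omega>"
  obtains \<D> where "countable \<D>" "\<D> \<subseteq> sets (lebesgue_on \<Omega>)"
    "\<And>A \<epsilon>. A \<in> sets (lebesgue_on \<Omega>) \<Longrightarrow> \<epsilon> > 0 \<Longrightarrow> \<exists>D\<in>\<D>. measure (lebesgue_on \<Omega>) (sym_diff A D) < \<epsilon>"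
proof -
  have lm: "\<Omega> \<in> lmeasurable" using assms by (simp add: lmeasurable_open)
  then have \<Omega>: "\<Omega> \<in> sets lebesgue" by auto
  let ?M = "lebesgue_on \<Omega>"
  interpret finite_measure ?M using lm by (rule finite_measure_lebesgue_on)
  obtain \<B> :: "'a set set" where \<B>: "countable \<B>" "topological_basis \<B>"
    using ex_countable_basis by blast
  define \<D> where "\<D> = (\<lambda>F. \<Union>F \<inter> \<Omega>) ` {F. finite F \<and> F \<subseteq> \<B>}"
  have "countable \<D>"
    unfolding \<D>_def using countable_Collect_finite_subset[OF \<B>(1)] by auto
  moreover have "\<D> \<subseteq> sets ?M"
  proof
    fix D assume "D \<in> \<D>"
    then obtain F where F: "F \<subseteq> \<B>" "D = \<Union>F \<inter> \<Omega>" by (auto simp: \<D>_def)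
    then have "open D"
      using assms(1) topological_basis_open[OF \<B>(2)] by (auto intro!: open_Int open_Union)
    then show "D \<in> sets ?M"
      using F(2) by (auto simp: sets_lebesgue_on_iff[OF \<Omega>])
  qed
  moreover have "\<exists>D\<in>\<D>. measure ?M (sym_diff A D) < \<epsilon>" if A: "A \<in> sets ?M" and \<epsilon>: "\<epsilon> > 0" for A \<epsilon>
  proof -
    have A': "A \<subseteq> \<Omega>" "A \<in> sets lebesgue" using A by (auto simp: sets_lebesgue_on_iff[OF \<Omega>])
    obtain T where T: "open T" "A \<subseteq> T" "T - A \<in> lmeasurable" "emeasure lebesgue (T - A) < ennreal (\<epsilon> / 2)"
      using sets_lebesgue_outer_open[OF A'(2), of "\<epsilon> / 2"] \<epsilon> by auto
    define U where "U = T \<inter> \<Omega>"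
    have U: "U \<in> sets ?M"
      using T(1) assms(1) by (auto simp: sets_lebesgue_on_iff[OF \<Omega>] U_def)
    have UA: "measure ?M (U - A) < \<epsilon> / 2"
    proof -
      have "measure ?M (U - A) = measure lebesgue (U - A)"
        using \<Omega> by (intro measure_restrict_space) (auto simp: U_def)
      also have "\<dots> \<le> measure lebesgue (T - A)"
        using T(3) U A by (intro measure_mono_fmeasurable) (auto simp: U_def sets_lebesgue_on_iff[OF \<Omega>])
      also have "\<dots> < \<epsilon> / 2"
        using T(3,4) \<epsilon> by (simp add: emeasure_eq_measure2 ennreal_less_iff)
      finally show ?thesis .
    qed
    obtain \<B>' where \<B>': "\<B>' \<subseteq> \<B>" "T = \<Union>\<B>'"
      using \<B>(2) T(1) unfolding topological_basis_def by metis
    \<comment> \<open>Adding the empty set makes the enumeration \<open>b\<close> possible even when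
      \<open>T\<close> is empty; it is discarded again in \<open>VD\<close>, since it need not
      belong to the basis.\<close>
    have cB': "countable (insert {} \<B>')" "insert {} \<B>' \<noteq> {}"
      using countable_subset[OF \<B>'(1) \<B>(1)] by auto
    define b where "b = from_nat_into (insert {} \<B>')"
    have b: "range b = insert {} \<B>'"
      unfolding b_def using cB' by (intro range_from_nat_into)
    define V where "V = (\<lambda>n. (\<Union>i<n. b i) \<inter> \<Omega>)"
    have VD: "V n \<in> \<D>" for n
    proof -
      have "V n = \<Union>(b ` {..<n} - {{}}) \<inter> \<Omega>" by (auto simp: V_def)
      moreover have "b ` {..<n} - {{}} \<subseteq> \<B>" using b \<B>'(1) by blast
      ultimately show ?thesis unfolding \<D>_def by auto
    qed
    then have VM: "V n \<in> sets ?M" for n using \<open>\<D> \<subseteq> sets ?M\<close> by blast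
    have "(\<lambda>n. measure ?M (U - V n)) \<longlonglongrightarrow> measure ?M (\<Inter>n. U - V n)"
      using U VM by (intro finite_Lim_measure_decseq) (fastforce simp: decseq_def V_def)+
    moreover have "(\<Inter>n. U - V n) = {}"
    proof -
      have "x \<in> (\<Union>n. V n)" if x: "x \<in> U" for x
      proof -
        have "x \<in> \<Union>(range b)" using x \<B>'(2) by (simp add: U_def b)
        then obtain i where "x \<in> b i" by blast
        then have "x \<in> V (Suc i)" using x by (auto simp: V_def U_def)
        then show ?thesis by blast
      qed
      then show ?thesis by auto
    qed
    ultimately have "(\<lambda>n. measure ?M (U - V n)) \<longlonglongrightarrow> 0" by (simp only: measure_empty)
    then have "\<forall>\<^sub>F n in sequentially. measure ?M (U - V n) < \<epsilon> / 2"
      using \<epsilon> by (intro order_tendstoD(2)) auto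
    then obtain n where n: "measure ?M (U - V n) < \<epsilon> / 2"
      by (auto simp: eventually_sequentially)
    have "V n \<subseteq> U" using b \<B>'(2) by (auto simp: V_def U_def)
    then have sub: "sym_diff A (V n) \<subseteq> (U - A) \<union> (U - V n)"
      using T(2) A'(1) by (auto simp: U_def)
    have m: "U - A \<in> sets ?M" "U - V n \<in> sets ?M"
      using U VM A by (blast intro: sets.Diff)+
    have "measure ?M (sym_diff A (V n)) \<le> measure ?M ((U - A) \<union> (U - V n))"
      using sub m by (blast intro: finite_measure_mono sets.Un)
    also have "\<dots> \<le> measure ?M (U - A) + measure ?M (U - V n)"
      using m by (intro measure_subadditive) auto
    also have "\<dots> < \<epsilon>" using UA n by linarith
    finally show ?thesis using VD by blast
  qed
  ultimately show ?thesis by (rule that)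
qed

text \<open>Inner regularity replaces \<open>A\<close> by a closed subset \<open>K\<close>, compact
  because \<open>\<Omega>\<close> is bounded. The cut-offs
  \<open>max 0 (1 - n * infdist x K)\<close> are \<open>n\<close>-Lipschitz, converge to the
  indicator of \<open>K\<close>, and vanish outside \<open>\<Omega>\<close> once \<open>n\<close>
  times the distance from \<open>K\<close> to the complement exceeds 1.\<close>

lemma indicator_approx_lipschitz:
  fixes \<Omega> :: "'a::euclidean_space set" and \<epsilon> :: real
  assumes \<Omega>: "open \<Omega>" "bounded \<Omega>" and A: "A \<in> sets (lebesgue_on \<Omega>)" and \<epsilon>: "\<epsilon> > 0"
  obtains \<psi> L where "L-lipschitz_on UNIV \<psi>" "\<And>x. x \<notin> \<Omega> \<Longrightarrow> \<psi> x = 0"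
    "(LINT x|lebesgue_on \<Omega>. (indicator A x - \<psi> x)\<^sup>2) < \<epsilon>"
proof -
  have lm: "\<Omega> \<in> lmeasurable" using \<Omega> by (simp add: lmeasurable_open)
  then have \<Omega>s: "\<Omega> \<in> sets lebesgue" by auto
  let ?M = "lebesgue_on \<Omega>"
  interpret finite_measure ?M using lm by (rule finite_measure_lebesgue_on)
  have A': "A \<subseteq> \<Omega>" "A \<in> sets lebesgue" using A by (auto simp: sets_lebesgue_on_iff[OF \<Omega>s])
  obtain K where K: "closed K" "K \<subseteq> A" "A - K \<in> lmeasurable" "emeasure lebesgue (A - K) < ennreal (\<epsilon> / 4)"
    using sets_lebesgue_inner_closed[OF A'(2), of "\<epsilon> / 4"] \<epsilon> by auto
  have KM: "K \<in> sets ?M" using K A' by (auto simp: sets_lebesgue_on_iff[OF \<Omega>s])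
  have AK: "(LINT x|?M. (indicator A x - indicator K x)\<^sup>2) < \<epsilon> / 4"
  proof -
    have "(LINT x|?M. (indicator A x - indicator K x)\<^sup>2) = (LINT x|?M. indicator (A - K) x :: real)"
      using K(2) by (intro Bochner_Integration.integral_cong) (auto simp: indicator_def)
    also have "\<dots> = measure ?M (A - K)"
    proof -
      have "(A - K) \<inter> \<Omega> = A - K" using A'(1) by blast
      then show ?thesis using A KM by simp
    qed
    also have "\<dots> = measure lebesgue (A - K)"
      using \<Omega>s A' by (intro measure_restrict_space) auto
    also have "\<dots> < \<epsilon> / 4"
      using K(3,4) \<epsilon> by (simp add: emeasure_eq_measure2 ennreal_less_iff)
    finally show ?thesis .
  qed
  show ?thesis
  \<comment> \<open>By convention \<open>infdist\<close> to the empty set is 0, so the cut-offs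
    would be constantly 1; the zero function serves instead.\<close>
  proof (cases "K = {}")
    case True
    show ?thesis
      by (rule that[of 0 "\<lambda>_. 0"]) (use AK True \<epsilon> in \<open>auto intro!: lipschitz_onI\<close>)
  next
    case False
    have cK: "compact K"
      using K(1,2) A'(1) \<Omega>(2) by (meson bounded_subset compact_eq_bounded_closed subset_trans)
    have "closed (- \<Omega>)" "K \<inter> - \<Omega> = {}" using \<Omega>(1) K(2) A'(1) by auto
    from separate_compact_closed[OF cK this]
    obtain d where d: "d > 0" "\<And>x y. x \<in> K \<Longrightarrow> y \<in> - \<Omega> \<Longrightarrow> d \<le> dist x y"
      by blast
    define \<psi> where "\<psi> = (\<lambda>n x. max 0 (1 - real n * infdist x K))"
    have lip: "(real n)-lipschitz_on UNIV (\<psi> n)" for n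
    proof (rule lipschitz_onI)
      fix x y :: 'a
      have "\<bar>\<psi> n x - \<psi> n y\<bar> \<le> \<bar>real n * (infdist x K - infdist y K)\<bar>"
        unfolding \<psi>_def right_diff_distrib by linarith
      also have "\<dots> \<le> real n * dist x y"
        by (simp add: abs_mult mult_left_mono infdist_triangle_abs)
      finally show "dist (\<psi> n x) (\<psi> n y) \<le> real n * dist x y" by (simp add: dist_real_def)
    qed simp
    have b: "0 \<le> \<psi> n x" "\<psi> n x \<le> 1" for n x
      by (auto simp: \<psi>_def infdist_nonneg)
    have meas: "\<psi> n \<in> borel_measurable ?M" for n
    proof -
      have "continuous_on UNIV (\<psi> n)" using lip by (rule lipschitz_on_continuous_on)
      then have "\<psi> n \<in> borel_measurable borel" by (rule borel_measurable_continuous_onI)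
      then have "\<psi> n \<in> borel_measurable lebesgue" by (intro measurable_completion) simp
      then show ?thesis by (rule measurable_restrict_space1)
    qed
    have lim: "(\<lambda>n. \<psi> n x) \<longlonglongrightarrow> indicator K x" for x
    proof (cases "x \<in> K")
      case True
      then have "\<psi> n x = 1" for n by (simp add: \<psi>_def)
      then show ?thesis using True by simp
    next
      case False
      then have pos: "infdist x K > 0"
        using K(1) \<open>K \<noteq> {}\<close> infdist_pos_not_in_closed by blast
      then obtain N where N: "1 < real N * infdist x K"
        using reals_Archimedean3 by blast
      have "\<psi> n x = 0" if "n \<ge> N" for n
      proof -
        have "real N * infdist x K \<le> real n * infdist x K" using that pos by (intro mult_right_mono) auto
        then show ?thesis using N by (simp add: \<psi>_def)
      qed
      then have "\<forall>\<^sub>F n in sequentially. \<psi> n x = 0" by (auto simp: eventually_sequentially)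
      then show ?thesis using False by (auto intro: tendsto_eventually)
    qed
    have "(\<lambda>n. LINT x|?M. (indicator K x - \<psi> n x)\<^sup>2) \<longlonglongrightarrow> (LINT x|?M. 0)"
    proof (rule integral_dominated_convergence[where w="\<lambda>_. 1"])
      show "AE x in ?M. (\<lambda>n. (indicator K x - \<psi> n x)\<^sup>2) \<longlonglongrightarrow> 0"
      proof (rule AE_I2)
        fix x
        have "(\<lambda>n. (indicator K x - \<psi> n x)\<^sup>2) \<longlonglongrightarrow> (indicator K x - indicator K x)\<^sup>2"
          by (intro tendsto_intros lim)
        then show "(\<lambda>n. (indicator K x - \<psi> n x)\<^sup>2) \<longlonglongrightarrow> 0" by simp
      qed
      show "AE x in ?M. norm ((indicator K x - \<psi> n x)\<^sup>2) \<le> 1" for n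
      proof (rule AE_I2)
        fix x
        have "\<bar>indicator K x - \<psi> n x\<bar> \<le> 1" using b[of n x] by (auto simp: indicator_def)
        then show "norm ((indicator K x - \<psi> n x)\<^sup>2) \<le> 1" by (simp add: abs_square_le_1)
      qed
    qed (use meas KM in auto)
    then have "(\<lambda>n. LINT x|?M. (indicator K x - \<psi> n x)\<^sup>2) \<longlonglongrightarrow> 0" by simp
    then have "\<forall>\<^sub>F n in sequentially. (LINT x|?M. (indicator K x - \<psi> n x)\<^sup>2) < \<epsilon> / 4"
      using \<epsilon> by (intro order_tendstoD(2)) auto
    moreover obtain N where N: "1 < real N * d" using reals_Archimedean3[OF d(1)] by blast
    ultimately obtain n where n: "n \<ge> N" "(LINT x|?M. (indicator K x - \<psi> n x)\<^sup>2) < \<epsilon> / 4"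
      using eventually_happens'[OF _ eventually_conj[OF eventually_ge_at_top[of N]]] by force
    show ?thesis
    proof (rule that[OF lip[of n]])
      fix y assume "y \<notin> \<Omega>"
      then have "d \<le> infdist y K"
        using d(2) \<open>K \<noteq> {}\<close> by (auto simp: infdist_notempty dist_commute intro!: cINF_greatest)
      then have "real N * d \<le> real n * infdist y K"
        using n(1) d(1) by (intro mult_mono) auto
      then show "\<psi> n y = 0" using N by (simp add: \<psi>_def)
    next
      have "square_integrable ?M (\<psi> n)"
        using b meas by (intro square_integrable_bounded[of _ 1]) (auto simp: abs_le_iff intro: order_trans[of _ 0])
      then show "(LINT x|?M. (indicator A x - \<psi> n x)\<^sup>2) < \<epsilon>"
        using square_integrable_triangle[of ?M "indicator A" "indicator K" "\<psi> n"] AK n(2)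
          square_integrable_indicator[OF A] square_integrable_indicator[OF KM] by linarith
    qed
  qed
qed

section \<open>Density of Lipschitz functions vanishing outside the domain\<close>

lemma L2_iff_square_integrable: "u \<in> L2 \<Omega> \<longleftrightarrow> square_integrable (lebesgue_on \<Omega>) u"
  by (simp add: L2_def square_integrable_def)

lemma lipschitz_in_L2:
  fixes \<psi> :: "'a::euclidean_space \<Rightarrow> real"
  assumes \<Omega>: "\<Omega> \<in> lmeasurable" "bounded \<Omega>" and lip: "L-lipschitz_on UNIV \<psi>"
  shows "\<psi> \<in> L2 \<Omega>"
proof -
  interpret finite_measure "lebesgue_on \<Omega>" using \<Omega>(1) by (rule finite_measure_lebesgue_on)
  have c: "continuous_on UNIV \<psi>" using lip by (rule lipschitz_on_continuous_on)
  then have "\<psi> \<in> borel_measurable borel" by (rule borel_measurable_continuous_onI)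
  then have "\<psi> \<in> borel_measurable lebesgue" by (intro measurable_completion) simp
  then have m: "\<psi> \<in> borel_measurable (lebesgue_on \<Omega>)" by (rule measurable_restrict_space1)
  have "compact (\<psi> ` closure \<Omega>)"
    using \<Omega>(2) c by (intro compact_continuous_image) (auto intro: continuous_on_subset)
  then obtain B where "\<And>x. x \<in> closure \<Omega> \<Longrightarrow> \<bar>\<psi> x\<bar> \<le> B"
    using compact_imp_bounded by (fastforce simp: bounded_iff)
  then show ?thesis
    unfolding L2_iff_square_integrable
    using closure_subset[of \<Omega>] by (intro square_integrable_bounded[OF m]) auto
qed

text \<open>Simple functions are dense, indicators are covered by the cut-offs above, and Lipschitz
  functions vanishing outside \<open>\<Omega>\<close> form a linear space, so approximability passes
  to all simple functions by induction.\<close>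

lemma L2_approx_lipschitz:
  fixes v :: "'a::euclidean_space \<Rightarrow> real"
  assumes \<Omega>: "open \<Omega>" "bounded \<Omega>" and v: "v \<in> L2 \<Omega>" and \<epsilon>: "\<epsilon> > 0"
  obtains \<psi> L where "L-lipschitz_on UNIV \<psi>" "\<And>x. x \<notin> \<Omega> \<Longrightarrow> \<psi> x = 0" "\<psi> \<in> L2 \<Omega>"
    "(LINT x|lebesgue_on \<Omega>. (v x - \<psi> x)\<^sup>2) < \<epsilon>"
proof -
  have lm: "\<Omega> \<in> lmeasurable" using \<Omega> by (simp add: lmeasurable_open)
  let ?M = "lebesgue_on \<Omega>"
  interpret finite_measure ?M using lm by (rule finite_measure_lebesgue_on)
  define good where "good = (\<lambda>\<psi>::'a \<Rightarrow> real. (\<exists>L. L-lipschitz_on UNIV \<psi>) \<and> (\<forall>x. x \<notin> \<Omega> \<longrightarrow> \<psi> x = 0))"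
  have good_L2: "square_integrable ?M \<psi>" if "good \<psi>" for \<psi>
    using that lipschitz_in_L2[OF lm \<Omega>(2)] by (auto simp: good_def L2_iff_square_integrable)
  define P where "P = (\<lambda>u. square_integrable ?M u \<and> (\<forall>\<epsilon>>0. \<exists>\<psi>. good \<psi> \<and> (LINT x|?M. (u x - \<psi> x)\<^sup>2) < \<epsilon>))"
  have simple: "P u" if "simple_function ?M u" for u
    using that
  proof (induction rule: simple_function_induct_real_signed)
    case (cong f g)
    have sg: "square_integrable ?M g" using cong(2) by (rule square_integrable_simple_function)
    have "(LINT x|?M. (g x - \<psi> x)\<^sup>2) = (LINT x|?M. (f x - \<psi> x)\<^sup>2)" if "good \<psi>" for \<psi>
    proof (rule integral_cong_AE)
      have [measurable]: "f \<in> borel_measurable ?M" "g \<in> borel_measurable ?M" "\<psi> \<in> borel_measurable ?M"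
        using cong(1,2) good_L2[OF that] by (auto simp: square_integrable_def intro: borel_measurable_simple_function)
      show "(\<lambda>x. (g x - \<psi> x)\<^sup>2) \<in> borel_measurable ?M" "(\<lambda>x. (f x - \<psi> x)\<^sup>2) \<in> borel_measurable ?M"
        by measurable
      show "AE x in ?M. (g x - \<psi> x)\<^sup>2 = (f x - \<psi> x)\<^sup>2"
        using cong(3) by eventually_elim simp
    qed
    then show ?case using cong(4) sg unfolding P_def by metis
  next
    case (set A)
    show ?case
      unfolding P_def
    proof (intro conjI allI impI)
      show "square_integrable ?M (indicator A)" using set by (rule square_integrable_indicator)
      fix \<epsilon> :: real assume "\<epsilon> > 0"
      from indicator_approx_lipschitz[OF \<Omega> set this]
      obtain \<psi> L where "L-lipschitz_on UNIV \<psi>" "\<And>x. x \<notin> \<Omega> \<Longrightarrow> \<psi> x = 0"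
        "(LINT x|?M. (indicator A x - \<psi> x)\<^sup>2) < \<epsilon>" by blast
      then show "\<exists>\<psi>. good \<psi> \<and> (LINT x|?M. (indicator A x - \<psi> x)\<^sup>2) < \<epsilon>"
        unfolding good_def by blast
    qed
  next
    case (mult u c)
    have su: "square_integrable ?M u" using mult by (simp add: P_def)
    show ?case
      unfolding P_def
    proof (intro conjI allI impI)
      show "square_integrable ?M (\<lambda>x. c * u x)" using su by (rule square_integrable_cmult)
      fix \<epsilon> :: real assume \<epsilon>: "\<epsilon> > 0"
      \<comment> \<open>The tolerance is divided by \<open>c\<^sup>2 + 1\<close> instead of
        \<open>c\<^sup>2\<close> so that \<open>c = 0\<close> needs no separate case.\<close>
      have c1: "0 < c\<^sup>2 + 1" by (intro add_nonneg_pos) auto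
      then have "\<epsilon> / (c\<^sup>2 + 1) > 0" using \<epsilon> by simp
      then obtain \<psi> where \<psi>: "good \<psi>" "(LINT x|?M. (u x - \<psi> x)\<^sup>2) < \<epsilon> / (c\<^sup>2 + 1)"
        using mult unfolding P_def by blast
      have "good (\<lambda>x. c * \<psi> x)"
        using \<psi>(1) lipschitz_on_cmult_real unfolding good_def by fastforce
      moreover have "(LINT x|?M. (c * u x - c * \<psi> x)\<^sup>2) < \<epsilon>"
      proof -
        have "(LINT x|?M. (c * u x - c * \<psi> x)\<^sup>2) = (LINT x|?M. c\<^sup>2 * (u x - \<psi> x)\<^sup>2)"
          by (simp only: right_diff_distrib[symmetric] power_mult_distrib)
        also have "\<dots> = c\<^sup>2 * (LINT x|?M. (u x - \<psi> x)\<^sup>2)" by simp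
        also have "\<dots> \<le> (c\<^sup>2 + 1) * (LINT x|?M. (u x - \<psi> x)\<^sup>2)"
          by (intro mult_right_mono) auto
        also have "\<dots> < (c\<^sup>2 + 1) * (\<epsilon> / (c\<^sup>2 + 1))"
          using \<psi>(2) c1 by (rule mult_strict_left_mono)
        also have "\<dots> = \<epsilon>" using c1 by simp
        finally show ?thesis .
      qed
      ultimately show "\<exists>\<psi>. good \<psi> \<and> (LINT x|?M. (c * u x - \<psi> x)\<^sup>2) < \<epsilon>"
        by blast
    qed
  next
    case (add u w)
    have su: "square_integrable ?M u" "square_integrable ?M w" using add by (auto simp: P_def)
    show ?case
      unfolding P_def
    proof (intro conjI allI impI)
      show "square_integrable ?M (\<lambda>x. u x + w x)" using su by (rule square_integrable_add)
      fix \<epsilon> :: real assume "\<epsilon> > 0"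
      then have \<epsilon>: "\<epsilon> / 4 > 0" by simp
      obtain \<psi> where \<psi>: "good \<psi>" "(LINT x|?M. (u x - \<psi> x)\<^sup>2) < \<epsilon> / 4"
        using add(1) \<epsilon> unfolding P_def by blast
      obtain \<eta> where \<eta>: "good \<eta>" "(LINT x|?M. (w x - \<eta> x)\<^sup>2) < \<epsilon> / 4"
        using add(2) \<epsilon> unfolding P_def by blast
      have "good (\<lambda>x. \<psi> x + \<eta> x)"
        using \<psi>(1) \<eta>(1) lipschitz_on_add unfolding good_def by fastforce
      moreover have "(LINT x|?M. (u x + w x - (\<psi> x + \<eta> x))\<^sup>2) < \<epsilon>"
      proof -
        \<comment> \<open>The two errors are written as the distance between
          \<open>u - \<psi>\<close> and \<open>\<eta> - w\<close>, so that the triangle inequality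
          applies with the zero function in the middle.\<close>
        have "(LINT x|?M. ((u x - \<psi> x) - (\<eta> x - w x))\<^sup>2) \<le>
            2 * (LINT x|?M. ((u x - \<psi> x) - 0)\<^sup>2) + 2 * (LINT x|?M. (0 - (\<eta> x - w x))\<^sup>2)"
          using su good_L2[OF \<psi>(1)] good_L2[OF \<eta>(1)]
          by (intro square_integrable_triangle square_integrable_diff) (auto simp: square_integrable_def)
        then show ?thesis
          using \<psi>(2) \<eta>(2) by (simp add: algebra_simps)
      qed
      ultimately show "\<exists>\<psi>. good \<psi> \<and> (LINT x|?M. (u x + w x - \<psi> x)\<^sup>2) < \<epsilon>"
        by blast
    qed
  qed
  have sv: "square_integrable ?M v" using v by (simp add: L2_iff_square_integrable)
  obtain s where s: "\<And>i. simple_function ?M (s i)" "\<And>i. square_integrable ?M (s i)"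
      "(\<lambda>i. LINT x|?M. (v x - s i x)\<^sup>2) \<longlonglongrightarrow> 0"
    using square_integrable_simple_approx[OF sv] by blast
  have \<epsilon>4: "\<epsilon> / 4 > 0" using \<epsilon> by simp
  then have "\<forall>\<^sub>F i in sequentially. (LINT x|?M. (v x - s i x)\<^sup>2) < \<epsilon> / 4"
    using s(3) by (intro order_tendstoD(2))
  then obtain i where i: "(LINT x|?M. (v x - s i x)\<^sup>2) < \<epsilon> / 4"
    by (auto simp: eventually_sequentially)
  obtain \<psi> where \<psi>: "good \<psi>" "(LINT x|?M. (s i x - \<psi> x)\<^sup>2) < \<epsilon> / 4"
    using simple[OF s(1)[of i]] \<epsilon>4 unfolding P_def by blast
  have "(LINT x|?M. (v x - \<psi> x)\<^sup>2) < \<epsilon>"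
    using square_integrable_triangle[OF sv s(2)[of i] good_L2[OF \<psi>(1)]] i \<psi>(2) by linarith
  then show ?thesis
    using that \<psi>(1) good_L2[OF \<psi>(1)] unfolding good_def L2_iff_square_integrable by blast
qed

section \<open>Gamma-convergence\<close>

lemma diagonal_eventually:
  fixes P :: "nat \<Rightarrow> nat \<Rightarrow> bool"
  assumes "\<And>k. \<forall>\<^sub>F n in sequentially. P k n"
  obtains \<kappa> :: "nat \<Rightarrow> nat" where "filterlim \<kappa> at_top sequentially" "\<forall>\<^sub>F n in sequentially. P (\<kappa> n) n"
proof -
  from assms obtain N where N: "\<And>k n. n \<ge> N k \<Longrightarrow> P k n"
    unfolding eventually_sequentially by metis
  define S where "S = (\<lambda>n. {k. k \<le> n \<and> (k = 0 \<or> N k \<le> n)})"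
  have S: "finite (S n)" "0 \<in> S n" for n
    by (auto simp: S_def)
  define \<kappa> where "\<kappa> = (\<lambda>n. Max (S n))"
  have \<kappa>S: "\<kappa> n \<in> S n" for n
    unfolding \<kappa>_def using S by (intro Max_in) auto
  show ?thesis
  proof (rule that)
    show "filterlim \<kappa> at_top sequentially"
      unfolding filterlim_at_top eventually_sequentially
    proof (intro allI exI impI)
      fix K n assume "max K (N K) \<le> n"
      then have "K \<in> S n" by (auto simp: S_def)
      then show "K \<le> \<kappa> n" unfolding \<kappa>_def using S by (intro Max_ge)
    qed
    have "P (\<kappa> n) n" if "n \<ge> N 0" for n
      using \<kappa>S[of n] that N by (auto simp: S_def)
    then show "\<forall>\<^sub>F n in sequentially. P (\<kappa> n) n"
      by (auto simp: eventually_sequentially)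
  qed
qed

text \<open>The difference of the squared norms is the squared distance plus twice the inner product
  of \<open>u n - v\<close> with \<open>v\<close>; Cauchy-Schwarz controls the latter.\<close>

lemma square_integrable_norm_tendsto:
  assumes v: "square_integrable M v" and u: "\<And>n. square_integrable M (u n)"
    and lim: "(\<lambda>n. LINT x|M. (u n x - v x)\<^sup>2) \<longlonglongrightarrow> 0"
  shows "(\<lambda>n. LINT x|M. (u n x)\<^sup>2) \<longlonglongrightarrow> (LINT x|M. (v x)\<^sup>2)"
proof -
  define \<delta> where "\<delta> = (\<lambda>n. LINT x|M. (u n x - v x)\<^sup>2)"
  have d: "square_integrable M (\<lambda>x. u n x - v x)" for n
    using u v by (intro square_integrable_diff)
  have eq: "(LINT x|M. (u n x)\<^sup>2) - (LINT x|M. (v x)\<^sup>2) = \<delta> n + 2 * (LINT x|M. (u n x - v x) * v x)" for n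
  proof -
    have "(LINT x|M. (u n x)\<^sup>2) = (LINT x|M. (u n x - v x)\<^sup>2 + 2 * ((u n x - v x) * v x) + (v x)\<^sup>2)"
      by (intro Bochner_Integration.integral_cong) (auto simp: power2_eq_square algebra_simps)
    then show ?thesis
      using d[of n] v square_integrable_mult[OF d[of n] v] unfolding \<delta>_def
      by (simp add: square_integrable_def)
  qed
  have "(\<lambda>n. (LINT x|M. (u n x)\<^sup>2) - (LINT x|M. (v x)\<^sup>2)) \<longlonglongrightarrow> 0"
  proof (rule tendsto_rabs_zero_cancel, rule tendsto_sandwich[OF always_eventually always_eventually])
    show "\<forall>n. 0 \<le> \<bar>(LINT x|M. (u n x)\<^sup>2) - (LINT x|M. (v x)\<^sup>2)\<bar>" by simp
    show "\<forall>n. \<bar>(LINT x|M. (u n x)\<^sup>2) - (LINT x|M. (v x)\<^sup>2)\<bar> \<le> \<delta> n + 2 * sqrt (\<delta> n * (LINT x|M. (v x)\<^sup>2))"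
    proof
      fix n
      have "0 \<le> \<delta> n" by (simp add: \<delta>_def)
      moreover have "\<bar>LINT x|M. (u n x - v x) * v x\<bar> \<le> sqrt (\<delta> n * (LINT x|M. (v x)\<^sup>2))"
        unfolding \<delta>_def by (rule integral_Cauchy_Schwarz[OF d v])
      ultimately show "\<bar>(LINT x|M. (u n x)\<^sup>2) - (LINT x|M. (v x)\<^sup>2)\<bar> \<le> \<delta> n + 2 * sqrt (\<delta> n * (LINT x|M. (v x)\<^sup>2))"
        unfolding eq by linarith
    qed
    have "(\<lambda>n. \<delta> n + 2 * sqrt (\<delta> n * (LINT x|M. (v x)\<^sup>2))) \<longlonglongrightarrow> 0 + 2 * sqrt (0 * (LINT x|M. (v x)\<^sup>2))"
      using lim unfolding \<delta>_def by (intro tendsto_intros)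
    then show "(\<lambda>n. \<delta> n + 2 * sqrt (\<delta> n * (LINT x|M. (v x)\<^sup>2))) \<longlonglongrightarrow> 0" by simp
  qed simp
  then show ?thesis by (simp add: LIM_zero_iff)
qed

section \<open>Compactness and the two Gamma-inequalities\<close>

lemma F_zero_eq:
  fixes u :: "'a::euclidean_space \<Rightarrow> real"
  shows "F_zero \<Omega> u = real DIM('a) * measure lebesgue (ball (0::'a) 1) / 2 * (LINT x|lebesgue_on \<Omega>. (u x)\<^sup>2)"
  by (simp add: F_zero_def L2_norm_def)

text \<open>With \<open>D \<ge> 1\<close> and \<open>s n < 1\<close>, the factor
  \<open>D powr (- 2 * s n)\<close> is at least \<open>D powr (- 2)\<close>; this makes the
  \<open>L2\<close> bound uniform in \<open>n\<close>.\<close>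

lemma F_frac_compactness:
  fixes \<Omega> :: "'a::euclidean_space set" and s :: "nat \<Rightarrow> real"
  assumes \<Omega>: "open \<Omega>" "bounded \<Omega>" and s: "\<And>n. 0 < s n \<and> s n < 1"
    and D: "D \<ge> 1" "\<And>x y. x \<in> \<Omega> \<Longrightarrow> y \<in> \<Omega> \<Longrightarrow> dist x y < D"
    and u: "\<And>n. u n \<in> L2 \<Omega>" and bound: "(SUP n. ennreal (s n) * F_frac \<Omega> (s n) (u n)) \<le> ennreal C"
  shows "\<exists>r v. strict_mono r \<and> v \<in> L2 \<Omega> \<and> L2_weakly_tendsto \<Omega> (\<lambda>k. u (r k)) v"
proof -
  have lm: "\<Omega> \<in> lmeasurable" using \<Omega> by (simp add: lmeasurable_open)
  interpret finite_measure "lebesgue_on \<Omega>" using lm by (rule finite_measure_lebesgue_on)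
  define c where "c = real DIM('a) * measure lebesgue (ball (0::'a) 1) / 2"
  have c: "c > 0" using content_ball_pos[of 1 "0::'a"] by (simp add: c_def)
  have B: "(LINT x|lebesgue_on \<Omega>. (u n x)\<^sup>2) \<le> max C 0 * D\<^sup>2 / c" for n
  proof -
    let ?q = "LINT x|lebesgue_on \<Omega>. (u n x)\<^sup>2"
    have "ennreal (D powr (- 2 * s n) * F_zero \<Omega> (u n)) \<le> ennreal (s n) * F_frac \<Omega> (s n) (u n)"
      using D s by (intro F_frac_lower_bound[OF \<Omega>(1) u]) auto
    also have "\<dots> \<le> ennreal C"
      using bound by (rule order_trans[rotated]) (intro SUP_upper, simp)
    \<comment> \<open>\<open>ennreal C\<close> is 0 for negative \<open>C\<close>, hence the maximum
      with 0.\<close>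
    finally have 1: "D powr (- 2 * s n) * F_zero \<Omega> (u n) \<le> max C 0"
      by (auto simp: ennreal_le_iff2)
    have "D powr (- 2) \<le> D powr (- 2 * s n)"
      using D(1) s[of n] by (intro powr_mono) auto
    then have "D powr (- 2) * F_zero \<Omega> (u n) \<le> D powr (- 2 * s n) * F_zero \<Omega> (u n)"
      by (intro mult_right_mono) (auto simp: F_zero_def)
    with 1 have "D powr (- 2) * (c * ?q) \<le> max C 0"
      by (simp only: F_zero_eq c_def)
    then show ?thesis
      using D(1) c by (simp add: powr_minus powr_numeral field_simps)
  qed
  obtain \<D> where \<D>: "countable \<D>" "\<D> \<subseteq> sets (lebesgue_on \<Omega>)"
    "\<And>A \<epsilon>. A \<in> sets (lebesgue_on \<Omega>) \<Longrightarrow> \<epsilon> > 0 \<Longrightarrow> \<exists>D\<in>\<D>. measure (lebesgue_on \<Omega>) (sym_diff A D) < \<epsilon>"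
    using countable_dense_sets_lebesgue_on[OF \<Omega>] by blast
  have su: "square_integrable (lebesgue_on \<Omega>) (u n)" for n
    using u by (simp add: L2_iff_square_integrable)
  obtain r w where r: "strict_mono r" and w: "square_integrable (lebesgue_on \<Omega>) w"
    and lim: "\<And>\<phi>. square_integrable (lebesgue_on \<Omega>) \<phi> \<Longrightarrow>
      (\<lambda>n. LINT x|lebesgue_on \<Omega>. u (r n) x * \<phi> x) \<longlonglongrightarrow> (LINT x|lebesgue_on \<Omega>. w x * \<phi> x)"
    using weak_compactness[of \<D> u, OF \<D> su B] by blast
  have "L2_weakly_tendsto \<Omega> (\<lambda>k. u (r k)) w"
    unfolding L2_weakly_tendsto_def L2_inner_def using lim by (simp add: L2_iff_square_integrable)
  moreover have "w \<in> L2 \<Omega>"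
    using w by (simp add: L2_iff_square_integrable)
  ultimately show ?thesis using r by blast
qed

lemma F_frac_Gamma_liminf:
  fixes \<Omega> :: "'a::euclidean_space set" and s :: "nat \<Rightarrow> real"
  assumes \<Omega>: "open \<Omega>" and s: "\<And>n. 0 < s n \<and> s n < 1" "s \<longlonglongrightarrow> 0"
    and D: "D \<ge> 1" "\<And>x y. x \<in> \<Omega> \<Longrightarrow> y \<in> \<Omega> \<Longrightarrow> dist x y < D"
    and v: "v \<in> L2 \<Omega>" and u: "\<And>n. u n \<in> L2 \<Omega>" and weak: "L2_weakly_tendsto \<Omega> u v"
  shows "ennreal (F_zero \<Omega> v) \<le> liminf (\<lambda>n. ennreal (s n) * F_frac \<Omega> (s n) (u n))"
proof -
  let ?M = "lebesgue_on \<Omega>"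
  define c where "c = real DIM('a) * measure lebesgue (ball (0::'a) 1) / 2"
  have c: "c \<ge> 0" by (simp add: c_def)
  \<comment> \<open>\<open>\<parallel>u\<^sub>n\<parallel>\<^sup>2 \<ge> 2 \<langle>u\<^sub>n, v\<rangle> - \<parallel>v\<parallel>\<^sup>2\<close>, and the right-hand side converges to \<open>\<parallel>v\<parallel>\<^sup>2\<close>.\<close>
  define a where "a = (\<lambda>n. D powr (- 2 * s n) * (c * (2 * L2_inner \<Omega> (u n) v - (LINT x|?M. (v x)\<^sup>2))))"
  have sv: "square_integrable ?M v" "square_integrable ?M (u n)" for n
    using v u by (auto simp: L2_iff_square_integrable)
  have a: "ennreal (a n) \<le> ennreal (s n) * F_frac \<Omega> (s n) (u n)" for n
  proof -
    have "0 \<le> (LINT x|?M. (u n x - v x)\<^sup>2)" by simp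
    also have "\<dots> = (LINT x|?M. (u n x)\<^sup>2 - 2 * (u n x * v x) + (v x)\<^sup>2)"
      by (intro Bochner_Integration.integral_cong) (auto simp: power2_diff)
    also have "\<dots> = (LINT x|?M. (u n x)\<^sup>2) - 2 * L2_inner \<Omega> (u n) v + (LINT x|?M. (v x)\<^sup>2)"
      using sv square_integrable_mult[OF sv(2)[of n] sv(1)]
      by (simp add: square_integrable_def L2_inner_def)
    finally have "a n \<le> D powr (- 2 * s n) * F_zero \<Omega> (u n)"
      unfolding a_def F_zero_eq c_def[symmetric] using c by (intro mult_left_mono) auto
    \<comment> \<open>\<open>a n\<close> may be negative; \<open>ennreal\<close> truncates it to 0
      monotonically and continuously, so both the inequality and the later limit survive.\<close>
    then have "ennreal (a n) \<le> ennreal (D powr (- 2 * s n) * F_zero \<Omega> (u n))"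
      by (rule ennreal_leI)
    also have "\<dots> \<le> ennreal (s n) * F_frac \<Omega> (s n) (u n)"
      using D s(1) by (intro F_frac_lower_bound[OF \<Omega> u]) auto
    finally show ?thesis .
  qed
  have "(\<lambda>n. L2_inner \<Omega> (u n) v) \<longlonglongrightarrow> L2_inner \<Omega> v v"
    using weak v by (simp add: L2_weakly_tendsto_def)
  then have "a \<longlonglongrightarrow> D powr (- 2 * 0) * (c * (2 * L2_inner \<Omega> v v - (LINT x|?M. (v x)\<^sup>2)))"
    unfolding a_def using D(1) by (intro tendsto_intros s(2)) auto
  also have "D powr (- 2 * 0) * (c * (2 * L2_inner \<Omega> v v - (LINT x|?M. (v x)\<^sup>2))) = F_zero \<Omega> v"
    using D(1) by (simp add: F_zero_eq c_def L2_inner_def power2_eq_square)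
  finally have "(\<lambda>n. ennreal (a n)) \<longlonglongrightarrow> ennreal (F_zero \<Omega> v)"
    by (rule tendsto_ennrealI)
  then have "ennreal (F_zero \<Omega> v) = liminf (\<lambda>n. ennreal (a n))"
    by (intro lim_imp_Liminf[symmetric]) auto
  also have "\<dots> \<le> liminf (\<lambda>n. ennreal (s n) * F_frac \<Omega> (s n) (u n))"
    using a by (intro Liminf_mono always_eventually) auto
  finally show ?thesis .
qed

text \<open>The upper bound holds for each Lipschitz approximant with its own constant, so the index
  of the approximant must be tied to \<open>n\<close>. Full convergence follows because the lower
  bound holds for the same functions.\<close>

lemma F_frac_Gamma_limsup:
  fixes \<Omega> :: "'a::euclidean_space set" and s :: "nat \<Rightarrow> real"
  assumes \<Omega>: "open \<Omega>" "bounded \<Omega>" and s: "\<And>n. 0 < s n \<and> s n < 1" "s \<longlonglongrightarrow> 0"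
    and D: "D \<ge> 1" "\<And>x y. x \<in> \<Omega> \<Longrightarrow> y \<in> \<Omega> \<Longrightarrow> dist x y < D"
    and v: "v \<in> L2 \<Omega>"
  shows "\<exists>u. (\<forall>n. u n \<in> L2 \<Omega>) \<and> L2_strongly_tendsto \<Omega> u v \<and>
    (\<lambda>n. ennreal (s n) * F_frac \<Omega> (s n) (u n)) \<longlonglongrightarrow> ennreal (F_zero \<Omega> v)"
proof -
  let ?M = "lebesgue_on \<Omega>"
  \<comment> \<open>Pairing each approximant with its constant lets one use of \<open>choice\<close>
    produce both sequences consistently.\<close>
  define Q where "Q = (\<lambda>k (\<psi>, C). \<psi> \<in> L2 \<Omega> \<and> (LINT x|?M. (\<psi> x - v x)\<^sup>2) < 1 / real (Suc k) \<and>
      (\<forall>t. 0 < t \<longrightarrow> t \<le> 1 / 2 \<longrightarrow> ennreal t * F_frac \<Omega> t \<psi> \<le> ennreal (F_zero \<Omega> \<psi> + t * C)))"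
  have "\<forall>k. \<exists>p. Q k p"
  proof
    fix k
    have "1 / real (Suc k) > 0" by simp
    from L2_approx_lipschitz[OF \<Omega> v this] obtain \<psi> L where
      \<psi>: "L-lipschitz_on UNIV \<psi>" "\<And>x. x \<notin> \<Omega> \<Longrightarrow> \<psi> x = 0" "\<psi> \<in> L2 \<Omega>"
        "(LINT x|?M. (v x - \<psi> x)\<^sup>2) < 1 / real (Suc k)"
      by blast
    obtain C where "\<And>t. 0 < t \<Longrightarrow> t \<le> 1 / 2 \<Longrightarrow> ennreal t * F_frac \<Omega> t \<psi> \<le> ennreal (F_zero \<Omega> \<psi> + t * C)"
      using F_frac_upper_bound_lipschitz[OF \<Omega> \<psi>(1,2,3)] by blast
    moreover have "(LINT x|?M. (\<psi> x - v x)\<^sup>2) < 1 / real (Suc k)"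
      using \<psi>(4) by (simp only: power2_commute)
    ultimately have "Q k (\<psi>, C)" using \<psi>(3) unfolding Q_def by blast
    then show "\<exists>p. Q k p" ..
  qed
  from choice[OF this] obtain p where p: "\<And>k. Q k (p k)" by blast
  define \<psi> where "\<psi> = fst \<circ> p"
  define C where "C = snd \<circ> p"
  have \<psi>: "\<psi> k \<in> L2 \<Omega>" "(LINT x|?M. (\<psi> k x - v x)\<^sup>2) < 1 / real (Suc k)" for k
    using p[of k] unfolding Q_def \<psi>_def case_prod_unfold comp_apply by blast+
  have C: "ennreal t * F_frac \<Omega> t (\<psi> k) \<le> ennreal (F_zero \<Omega> (\<psi> k) + t * C k)" if "0 < t" "t \<le> 1 / 2" for k t
    using p[of k] that unfolding Q_def \<psi>_def C_def case_prod_unfold comp_apply by blast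
  have "\<forall>\<^sub>F n in sequentially. s n < 1 / 2 \<and> s n * C k < 1 / real (Suc k)" for k
  proof (rule eventually_conj)
    show "\<forall>\<^sub>F n in sequentially. s n < 1 / 2"
      using s(2) by (rule order_tendstoD) simp
    have "(\<lambda>n. s n * C k) \<longlonglongrightarrow> 0 * C k" by (intro tendsto_intros s(2))
    then show "\<forall>\<^sub>F n in sequentially. s n * C k < 1 / real (Suc k)"
      by (rule order_tendstoD) simp
  qed
  \<comment> \<open>For fixed \<open>k\<close> the error \<open>s n * C k\<close> tends to 0, but
    \<open>C k\<close> may be unbounded in \<open>k\<close>; \<open>\<kappa>\<close> advances only
    when the error has dropped below \<open>1 / (k + 1)\<close>.\<close>
  from diagonal_eventually[of "\<lambda>k n. s n < 1 / 2 \<and> s n * C k < 1 / real (Suc k)", OF this]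
  obtain \<kappa> where \<kappa>: "filterlim \<kappa> at_top sequentially"
    "\<forall>\<^sub>F n in sequentially. s n < 1 / 2 \<and> s n * C (\<kappa> n) < 1 / real (Suc (\<kappa> n))"
    by blast
  define u where "u = (\<lambda>n. \<psi> (\<kappa> n))"
  have u: "u n \<in> L2 \<Omega>" for n by (simp add: u_def \<psi>)
  have inv: "(\<lambda>n. 1 / real (Suc (\<kappa> n))) \<longlonglongrightarrow> 0"
    using filterlim_compose[OF LIMSEQ_Suc[OF lim_inverse_n'] \<kappa>(1)] by simp
  have lim: "(\<lambda>n. LINT x|?M. (u n x - v x)\<^sup>2) \<longlonglongrightarrow> 0"
  proof (rule tendsto_sandwich[OF always_eventually always_eventually tendsto_const inv])
    show "\<forall>n. 0 \<le> (LINT x|?M. (u n x - v x)\<^sup>2)" by simp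
    show "\<forall>n. (LINT x|?M. (u n x - v x)\<^sup>2) \<le> 1 / real (Suc (\<kappa> n))"
      using \<psi>(2) by (auto simp only: u_def intro: less_imp_le)
  qed
  have strong: "L2_strongly_tendsto \<Omega> u v"
    using tendsto_real_sqrt[OF lim] by (simp add: L2_strongly_tendsto_def L2_norm_def)
  have "(\<lambda>n. LINT x|?M. (u n x)\<^sup>2) \<longlonglongrightarrow> (LINT x|?M. (v x)\<^sup>2)"
    using u v lim by (intro square_integrable_norm_tendsto) (auto simp: L2_iff_square_integrable)
  then have F0: "(\<lambda>n. F_zero \<Omega> (u n)) \<longlonglongrightarrow> F_zero \<Omega> v"
    unfolding F_zero_eq by (intro tendsto_intros)
  have "(\<lambda>n. ennreal (s n) * F_frac \<Omega> (s n) (u n)) \<longlonglongrightarrow> ennreal (F_zero \<Omega> v)"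
  \<comment> \<open>Both barriers are multiples or perturbations of
    \<open>F_zero \<Omega> (u n)\<close>, whose limit is known from strong convergence.\<close>
  proof (rule tendsto_sandwich)
    show "\<forall>\<^sub>F n in sequentially. ennreal (D powr (- 2 * s n) * F_zero \<Omega> (u n)) \<le> ennreal (s n) * F_frac \<Omega> (s n) (u n)"
      using D s(1) by (intro always_eventually allI F_frac_lower_bound[OF \<Omega>(1) u]) auto
    show "\<forall>\<^sub>F n in sequentially. ennreal (s n) * F_frac \<Omega> (s n) (u n) \<le> ennreal (F_zero \<Omega> (u n) + 1 / real (Suc (\<kappa> n)))"
      using \<kappa>(2)
    proof eventually_elim
      case (elim n)
      then have "ennreal (s n) * F_frac \<Omega> (s n) (u n) \<le> ennreal (F_zero \<Omega> (u n) + s n * C (\<kappa> n))"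
        unfolding u_def using s(1)[of n] by (intro C) auto
      also have "\<dots> \<le> ennreal (F_zero \<Omega> (u n) + 1 / real (Suc (\<kappa> n)))"
        using elim by (intro ennreal_leI) linarith
      finally show ?case .
    qed
    have "(\<lambda>n. D powr (- 2 * s n) * F_zero \<Omega> (u n)) \<longlonglongrightarrow> D powr (- 2 * 0) * F_zero \<Omega> v"
      using D(1) by (intro tendsto_intros s(2) F0) auto
    then show "(\<lambda>n. ennreal (D powr (- 2 * s n) * F_zero \<Omega> (u n))) \<longlonglongrightarrow> ennreal (F_zero \<Omega> v)"
      using D(1) by (intro tendsto_ennrealI) simp
    have "(\<lambda>n. F_zero \<Omega> (u n) + 1 / real (Suc (\<kappa> n))) \<longlonglongrightarrow> F_zero \<Omega> v + 0"
      by (intro tendsto_add F0 inv)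
    then show "(\<lambda>n. ennreal (F_zero \<Omega> (u n) + 1 / real (Suc (\<kappa> n)))) \<longlonglongrightarrow> ennreal (F_zero \<Omega> v)"
      by (intro tendsto_ennrealI) simp
  qed
  then show ?thesis using u strong by blast
qed

theorem theorem1p2:
  fixes \<Omega> :: "'a::euclidean_space set" and s :: "nat \<Rightarrow> real"
  assumes "open \<Omega>" and "bounded \<Omega>" and "lipschitz_boundary \<Omega>"
    and "\<And>n. 0 < s n \<and> s n < 1" and "s \<longlonglongrightarrow> 0"
  shows "(\<forall>u. (\<forall>n. u n \<in> L2 \<Omega>) \<longrightarrow>
            (\<exists>C::real. (SUP n. ennreal (s n) * F_frac \<Omega> (s n) (u n)) \<le> ennreal C) \<longrightarrow>
            (\<exists>r v. strict_mono r \<and> v \<in> L2 \<Omega> \<and> L2_weakly_tendsto \<Omega> (\<lambda>k. u (r k)) v))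
       \<and> (\<forall>v\<in>L2 \<Omega>. \<forall>u. (\<forall>n. u n \<in> L2 \<Omega>) \<longrightarrow> L2_weakly_tendsto \<Omega> u v \<longrightarrow>
            ennreal (F_zero \<Omega> v) \<le> liminf (\<lambda>n. ennreal (s n) * F_frac \<Omega> (s n) (u n)))
       \<and> (\<forall>v\<in>L2 \<Omega>. \<exists>u. (\<forall>n. u n \<in> L2 \<Omega>) \<and> L2_strongly_tendsto \<Omega> u v \<and>
            (\<lambda>n. ennreal (s n) * F_frac \<Omega> (s n) (u n)) \<longlonglongrightarrow> ennreal (F_zero \<Omega> v))"
proof -
  \<comment> \<open>The summand 1 makes the distance bound strict and ensures
    \<open>D \<ge> 1\<close>, even for an empty \<open>\<Omega>\<close>.\<close>
  define D where "D = diameter \<Omega> + 1"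
  have D1: "D \<ge> 1"
    using diameter_ge_0[OF assms(2)] by (simp add: D_def)
  have D2: "dist x y < D" if "x \<in> \<Omega>" "y \<in> \<Omega>" for x y
    using diameter_bounded_bound[OF assms(2) that] by (simp add: D_def)
  note D = D1 D2
  show ?thesis
  proof (intro conjI allI impI ballI)
    fix u :: "nat \<Rightarrow> 'a \<Rightarrow> real" assume u: "\<forall>n. u n \<in> L2 \<Omega>"
    assume "\<exists>C::real. (SUP n. ennreal (s n) * F_frac \<Omega> (s n) (u n)) \<le> ennreal C"
    then obtain C where C: "(SUP n. ennreal (s n) * F_frac \<Omega> (s n) (u n)) \<le> ennreal C" ..
    show "\<exists>r v. strict_mono r \<and> v \<in> L2 \<Omega> \<and> L2_weakly_tendsto \<Omega> (\<lambda>k. u (r k)) v"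
      by (rule F_frac_compactness[OF assms(1,2,4) D spec[OF u] C])
  next
    fix v and u :: "nat \<Rightarrow> 'a \<Rightarrow> real" assume v: "v \<in> L2 \<Omega>" and u: "\<forall>n. u n \<in> L2 \<Omega>" and weak: "L2_weakly_tendsto \<Omega> u v"
    show "ennreal (F_zero \<Omega> v) \<le> liminf (\<lambda>n. ennreal (s n) * F_frac \<Omega> (s n) (u n))"
      by (rule F_frac_Gamma_liminf[OF assms(1,4,5) D v spec[OF u] weak])
  next
    fix v assume v: "v \<in> L2 \<Omega>"
    show "\<exists>u. (\<forall>n. u n \<in> L2 \<Omega>) \<and> L2_strongly_tendsto \<Omega> u v \<and>
        (\<lambda>n. ennreal (s n) * F_frac \<Omega> (s n) (u n)) \<longlonglongrightarrow> ennreal (F_zero \<Omega> v)"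
      by (rule F_frac_Gamma_limsup[OF assms(1,2,4,5) D v])
  qed
qed

end
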